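(* Let $\Phi$ be a random formula with $n$ variables and $m\in\Theta(n)$ clauses drawn from the weighted geometric model on $\mathbb T^d$ equipped with a $\mathfrak p$-norm, with temperature $0<T<1$, with $W\in O(n)$, and with $w_v\in O(n^{1-\varepsilon})$ for every variable $v$ and some constant $\varepsilon>0$. Then with probability $1-O(1/n)$, $\Theta(m)$ clauses of $\Phi$ are nice.
   Context: $\mathbb T^d$ is $[0,1]^d$ with opposite faces identified ($d$ a fixed constant), with distance $\mathrm{dist}(p,q)=\left(\sum_{i=1}^d|p_i-q_i|_\circ^{\mathfrak p}\right)^{1/\mathfrak p}$ (and $\max_i|p_i-q_i|_\circ$ for $\mathfrak p=\infty$), where $|a-b|_\circ=\min\{|a-b|,1-|a-b|\}$ and $\mathfrak p\in\mathbb N^+\cup\{\infty\}$ is fixed. Weighted geometric $k$-SAT model ($k$ constant): $n$ variables with weights $w_v\ge1$, minimum $1$, total $W=\sum_v w_v$, and $m$ clauses; all get independent uniformly random positions in $\mathbb T^d$. Connection weight $X(c,v)=\left(w_v/\mathrm{dist}(c,v)^d\right)^{1/T}$. Each clause draws $k$ variables one after another without repetition, each draw among the remaining variables with probability proportional to $X(c,v)$; signs are chosen among the $2^k$ patterns (details irrelevant here). A clause $c$ is nice if, for each $j\in[k]$, the $j$-th variable drawn for $c$ is the variable with the $j$-th highest connection weight with $c$. *)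

theory Defs
  imports "HOL-Probability.Probability" "HOL-Library.Landau_Symbols"
begin

text \<open>Points of the torus T^d are represented as functions nat => real whose
  components 0..d-1 lie in [0,1).\<close>

definition circ_dist :: "real \<Rightarrow> real \<Rightarrow> real" where
  "circ_dist a b = min \<bar>a - b\<bar> (1 - \<bar>a - b\<bar>)"

definition torus_dist :: "enat \<Rightarrow> nat \<Rightarrow> (nat \<Rightarrow> real) \<Rightarrow> (nat \<Rightarrow> real) \<Rightarrow> real" where
  "torus_dist p d x y =
     (case p of
        enat q \<Rightarrow> (\<Sum>i<d. circ_dist (x i) (y i) ^ q) powr (1 / real q)
      | \<infinity> \<Rightarrow> Max ((\<lambda>i. circ_dist (x i) (y i)) ` {..<d}))"

definition torus_space :: "nat \<Rightarrow> (nat \<Rightarrow> real) measure" where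
  "torus_space d = PiM {..<d} (\<lambda>_. uniform_measure lborel {0..<1::real})"

definition positions_space ::
  "nat \<Rightarrow> nat \<Rightarrow> nat \<Rightarrow> ((nat \<Rightarrow> nat \<Rightarrow> real) \<times> (nat \<Rightarrow> nat \<Rightarrow> real)) measure" where
  "positions_space d n m =
     PiM {..<n} (\<lambda>_. torus_space d) \<Otimes>\<^sub>M PiM {..<m} (\<lambda>_. torus_space d)"

definition conn_weight ::
  "real \<Rightarrow> nat \<Rightarrow> enat \<Rightarrow> real \<Rightarrow> (nat \<Rightarrow> real) \<Rightarrow> (nat \<Rightarrow> real) \<Rightarrow> real" where
  "conn_weight T d p wv xc xv = (wv / torus_dist p d xc xv ^ d) powr (1 / T)"

definition weighted_pmf :: "nat set \<Rightarrow> (nat \<Rightarrow> real) \<Rightarrow> nat pmf" where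
  "weighted_pmf S f = embed_pmf (\<lambda>v. if v \<in> S then f v / (\<Sum>u\<in>S. f u) else 0)"

fun draw_seq :: "(nat \<Rightarrow> real) \<Rightarrow> nat set \<Rightarrow> nat \<Rightarrow> nat list pmf" where
  "draw_seq f S 0 = return_pmf []"
| "draw_seq f S (Suc j) =
     do { v \<leftarrow> weighted_pmf S f;
          vs \<leftarrow> draw_seq f (S - {v}) j;
          return_pmf (v # vs) }"

definition clause_draws ::
  "real \<Rightarrow> nat \<Rightarrow> enat \<Rightarrow> nat \<Rightarrow> (nat \<Rightarrow> real) \<Rightarrow> nat \<Rightarrow> nat \<Rightarrow>
   (nat \<Rightarrow> nat \<Rightarrow> real) \<Rightarrow> (nat \<Rightarrow> nat \<Rightarrow> real) \<Rightarrow> (nat \<Rightarrow> nat list) pmf" where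
  "clause_draws T d p k w n m xs cs =
     Pi_pmf {..<m} [] (\<lambda>c. draw_seq (\<lambda>v. conn_weight T d p (w v) (cs c) (xs v)) {..<n} k)"

text \<open>A clause with connection weights X (on variables 0..n-1) and drawn list vs is
  nice if for each j the j-th drawn variable has the j-th highest connection
  weight, i.e. it has strictly larger weight than every variable not among the
  first j+1 drawn ones.\<close>
definition nice_clause :: "nat \<Rightarrow> (nat \<Rightarrow> real) \<Rightarrow> nat list \<Rightarrow> bool" where
  "nice_clause n X vs =
     (\<forall>j < length vs. \<forall>u < n. u \<notin> set (take (Suc j) vs) \<longrightarrow> X u < X (vs ! j))"

definition num_nice ::
  "real \<Rightarrow> nat \<Rightarrow> enat \<Rightarrow> (nat \<Rightarrow> real) \<Rightarrow> nat \<Rightarrow> nat \<Rightarrow>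
   (nat \<Rightarrow> nat \<Rightarrow> real) \<Rightarrow> (nat \<Rightarrow> nat \<Rightarrow> real) \<Rightarrow> (nat \<Rightarrow> nat list) \<Rightarrow> nat" where
  "num_nice T d p w n m xs cs D =
     card {c \<in> {..<m}. nice_clause n (\<lambda>v. conn_weight T d p (w v) (cs c) (xs v)) (D c)}"

definition prob_num_nice ::
  "real \<Rightarrow> nat \<Rightarrow> enat \<Rightarrow> nat \<Rightarrow> (nat \<Rightarrow> real) \<Rightarrow> nat \<Rightarrow> nat \<Rightarrow> (nat \<Rightarrow> bool) \<Rightarrow> ennreal" where
  "prob_num_nice T d p k w n m P =
     (\<integral>\<^sup>+ xc. emeasure (measure_pmf (clause_draws T d p k w n m (fst xc) (snd xc)))
                 {D. P (num_nice T d p w n m (fst xc) (snd xc) D)}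
        \<partial>positions_space d n m)"

end

theory Submission
  imports Defs "HOL-Real_Asymp.Real_Asymp"
begin

text \<open>
  Measure the distance between a clause and a variable \<open>v\<close> in units of \<open>w\<^sub>v\<close> to the power \<open>1/d\<close>,
  and put \<open>k + 1\<close> geometrically growing radii at the scale where the expected number of variables
  within reach of a clause is a small constant. If each of the \<open>k\<close> shells between them contains
  exactly one variable and nothing else is within the largest radius, then the \<open>k\<close> highest connection
  weights are strictly ordered; if moreover the remaining weights sum to at most a constant multiple
  of the \<open>k\<close>-th highest one, the clause is nice with constant probability.

  The shell condition holds at a fixed point with constant probability. Hence the volume of the
  set of clause positions satisfying it has constant expectation, and moving one variable \<open>v\<close> changes
  this volume by \<open>O(w\<^sub>v/n)\<close>. Since the squares of these influences sum to a negative power of \<open>n\<close>,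
  McDiarmid's inequality keeps the volume bounded below. The sum condition needs no randomness of
  the variables: because \<open>T < 1\<close>, for almost every placement of the variables the integral of the far
  weights over the clause position is bounded, and Markov's inequality applies. Conditionally on
  the variable positions the clauses are independent, and two applications of Hoeffding's inequality
  finish the proof.
\<close>

section \<open>Product spaces\<close>

lemma finite_product_prob_spaceI:
  assumes "finite I" "\<And>i. prob_space (M i)"
  shows "finite_product_prob_space M I"
  by (intro finite_product_prob_space.intro finite_product_sigma_finite.intro
        finite_product_sigma_finite_axioms.intro product_sigma_finite.intro
        product_prob_spaceI prob_space_imp_sigma_finite assms)

lemma (in prob_space) nn_integral_ge_if_prob_ge:
  assumes A: "A \<in> events" "1 - a \<le> prob A" and f: "\<And>x. x \<in> A \<Longrightarrow> ennreal (1 - b) \<le> f x"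
    and nonneg: "0 \<le> a" "0 \<le> b"
  shows "ennreal (1 - (a + b)) \<le> (\<integral>\<^sup>+x. f x \<partial>M)"
proof (cases "b \<le> 1")
  case False
  then have "1 - (a + b) \<le> 0" using nonneg by linarith
  then show ?thesis by (simp add: ennreal_neg)
next
  case True
  have "(1 - b) * (1 - a) \<le> (1 - b) * prob A"
    using A(2) True by (intro mult_left_mono) auto
  moreover have "0 \<le> a * b" using nonneg by simp
  ultimately have "1 - (a + b) \<le> (1 - b) * prob A"
    by (simp add: algebra_simps)
  then have "ennreal (1 - (a + b)) \<le> ennreal (1 - b) * emeasure M A"
    using True by (simp add: emeasure_eq_measure ennreal_leI flip: ennreal_mult)
  also have "\<dots> = (\<integral>\<^sup>+x. ennreal (1 - b) * indicator A x \<partial>M)"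
    by (rule nn_integral_cmult_indicator[symmetric, OF A(1)])
  also have "\<dots> \<le> (\<integral>\<^sup>+x. f x \<partial>M)"
    by (intro nn_integral_mono) (auto simp: indicator_def f)
  finally show ?thesis .
qed

lemma (in pair_prob_space) integral_prob_section_swap:
  assumes [measurable]: "Measurable.pred (M1 \<Otimes>\<^sub>M M2) (\<lambda>(x, y). R x y)"
  shows "(\<integral>x. M2.prob {y \<in> space M2. R x y} \<partial>M1) = (\<integral>y. M1.prob {x \<in> space M1. R x y} \<partial>M2)"
proof -
  let ?f = "\<lambda>x y. indicator {(x, y). R x y} (x, y) :: real"
  have integrable: "integrable (M1 \<Otimes>\<^sub>M M2) (\<lambda>(x, y). ?f x y)"
    by (rule P.integrable_const_bound[where B = 1]) auto
  have "(\<integral>x. M2.prob {y \<in> space M2. R x y} \<partial>M1) = (\<integral>x. (\<integral>y. ?f x y \<partial>M2) \<partial>M1)"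
  proof (rule Bochner_Integration.integral_cong)
    fix x
    have "(\<integral>y. ?f x y \<partial>M2) = (\<integral>y. indicator {y \<in> space M2. R x y} y \<partial>M2)"
      by (rule Bochner_Integration.integral_cong) (auto simp: indicator_def)
    then show "M2.prob {y \<in> space M2. R x y} = (\<integral>y. ?f x y \<partial>M2)"
      by (simp add: Int_absorb2)
  qed simp
  also have "\<dots> = (\<integral>y. (\<integral>x. ?f x y \<partial>M1) \<partial>M2)"
    by (rule Fubini_integral[symmetric, OF integrable])
  also have "\<dots> = (\<integral>y. M1.prob {x \<in> space M1. R x y} \<partial>M2)"
  proof (rule Bochner_Integration.integral_cong)
    fix y
    have "(\<integral>x. ?f x y \<partial>M1) = (\<integral>x. indicator {x \<in> space M1. R x y} x \<partial>M1)"
      by (rule Bochner_Integration.integral_cong) (auto simp: indicator_def)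
    then show "(\<integral>x. ?f x y \<partial>M1) = M1.prob {x \<in> space M1. R x y}"
      by (simp add: Int_absorb2)
  qed simp
  finally show ?thesis .
qed

lemma fun_upd_in_space_PiM:
  "x \<in> space (PiM I M) \<Longrightarrow> i \<in> I \<Longrightarrow> y \<in> space (M i) \<Longrightarrow> x(i := y) \<in> space (PiM I M)"
  by (auto simp: space_PiM PiE_iff extensional_def)

lemma fun_upd_in_space_PiM_insert:
  "x \<in> space (PiM I M) \<Longrightarrow> y \<in> space (M i) \<Longrightarrow> x(i := y) \<in> space (PiM (insert i I) M)"
  by (auto simp: space_PiM PiE_iff extensional_def)

lemma (in finite_product_prob_space) indep_vars_PiM_components:
  "indep_vars M (\<lambda>i x. x i) I"
proof (cases "I = {}")
  case True
  then show ?thesis unfolding indep_vars_def indep_sets_def by simp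
next
  case False
  have "distr (PiM I M) (PiM I M) (\<lambda>x. \<lambda>i\<in>I. x i) = distr (PiM I M) (PiM I M) (\<lambda>x. x)"
    by (rule distr_cong) (auto simp: space_PiM)
  also have "\<dots> = PiM I M" by simp
  also have "\<dots> = PiM I (\<lambda>i. distr (PiM I M) (M i) (\<lambda>x. x i))"
    by (intro PiM_cong) (auto simp: PiM_component)
  finally show ?thesis
    by (subst indep_vars_iff_distr_eq_PiM'[OF False]) auto
qed

section \<open>Bounded differences\<close>

lemma (in prob_space) nn_integral_exp_le_if_oscillation_le:
  assumes f: "random_variable borel f" and l: "l > 0"
    and osc: "\<And>x y. x \<in> space M \<Longrightarrow> y \<in> space M \<Longrightarrow> f x - f y \<le> c"
  shows "(\<integral>\<^sup>+x. ennreal (exp (l * (f x - expectation f))) \<partial>M) \<le> ennreal (exp (l\<^sup>2 * c\<^sup>2 / 8))"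
proof -
  define a where "a = (INF x\<in>space M. f x)"
  obtain x0 where x0: "x0 \<in> space M" using not_empty by blast
  have "bdd_below (f ` space M)"
    using osc[OF x0] by (intro bdd_belowI2[of _ "f x0 - c"]) (simp add: algebra_simps)
  then have lower: "a \<le> f x" if "x \<in> space M" for x
    unfolding a_def using that by (rule cINF_lower)
  have "f x - c \<le> a" if "x \<in> space M" for x
    unfolding a_def using not_empty osc[OF that] by (intro cINF_greatest) (auto simp: algebra_simps)
  then have upper: "f x \<le> a + c" if "x \<in> space M" for x
    using that by (simp add: algebra_simps)
  interpret interval_bounded_random_variable M f a "a + c"
    by unfold_locales (use f lower upper in auto)
  show ?thesis
    using Hoeffdings_lemma_nn_integral[OF l] by simp
qed

definition bounded_differences ::
  "'i set \<Rightarrow> ('i \<Rightarrow> 'a measure) \<Rightarrow> ('i \<Rightarrow> real) \<Rightarrow> (('i \<Rightarrow> 'a) \<Rightarrow> real) \<Rightarrow> bool" where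
  "bounded_differences I M c f \<longleftrightarrow>
     (\<forall>x\<in>space (PiM I M). \<forall>i\<in>I. \<forall>y\<in>space (M i). \<bar>f (x(i := y)) - f x\<bar> \<le> c i)"

lemma bounded_differencesD:
  "bounded_differences I M c f \<Longrightarrow> x \<in> space (PiM I M) \<Longrightarrow> i \<in> I \<Longrightarrow> y \<in> space (M i) \<Longrightarrow>
     \<bar>f (x(i := y)) - f x\<bar> \<le> c i"
  by (simp add: bounded_differences_def)

lemma bounded_differences_uminus:
  "bounded_differences I M c f \<Longrightarrow> bounded_differences I M c (\<lambda>x. - f x)"
  by (simp add: bounded_differences_def abs_minus_commute)

lemma abs_diff_le_sum_if_bounded_differences:
  assumes diff: "bounded_differences I M c f" and "finite I"
    and x: "x \<in> space (PiM I M)" and y: "y \<in> space (PiM I M)"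
  shows "\<bar>f x - f y\<bar> \<le> sum c I"
proof -
  have "\<bar>f x - f y\<bar> \<le> sum c J"
    if "finite J" "J \<subseteq> I" "x \<in> space (PiM I M)" "\<And>i. i \<notin> J \<Longrightarrow> x i = y i" for J x
    using that
  proof (induction J arbitrary: x rule: finite_induct)
    case empty
    then have "x = y" by auto
    then show ?case by simp
  next
    case (insert j J)
    have yj: "y j \<in> space (M j)"
      using y insert.prems(1) by (auto simp: space_PiM PiE_iff)
    have "x(j := y j) \<in> space (PiM I M)"
      using fun_upd_in_space_PiM[OF insert.prems(2) _ yj] insert.prems(1) by simp
    then have "\<bar>f (x(j := y j)) - f y\<bar> \<le> sum c J"
      by (rule insert.IH[rotated]) (use insert.prems in auto)
    moreover have "\<bar>f (x(j := y j)) - f x\<bar> \<le> c j"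
      using bounded_differencesD[OF diff insert.prems(2) _ yj] insert.prems(1) by simp
    ultimately show ?case
      using insert.hyps by simp
  qed
  from this[OF \<open>finite I\<close> order_refl x] show ?thesis
    using x y by (auto simp: space_PiM PiE_iff extensional_def)
qed

context product_prob_space
begin

lemma integrable_if_bounded_differences:
  assumes "finite J" and f: "f \<in> borel_measurable (PiM J M)" and diff: "bounded_differences J M c f"
  shows "integrable (PiM J M) f"
proof -
  interpret J: prob_space "PiM J M" by (rule prob_space_PiM) (rule prob_space)
  obtain y where y: "y \<in> space (PiM J M)" using J.not_empty by blast
  have "norm (f x) \<le> \<bar>f y\<bar> + sum c J" if "x \<in> space (PiM J M)" for x
    using abs_diff_le_sum_if_bounded_differences[OF diff \<open>finite J\<close> that y] by simp
  then show ?thesis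
    using f by (intro J.integrable_const_bound[where B = "\<bar>f y\<bar> + sum c J"]) auto
qed

context
  fixes i :: 'i and J :: "'i set" and f :: "('i \<Rightarrow> 'a) \<Rightarrow> real" and c :: "'i \<Rightarrow> real"
  assumes J: "finite J" "i \<notin> J"
    and f [measurable]: "f \<in> borel_measurable (PiM (insert i J) M)"
    and diff: "bounded_differences (insert i J) M c f"
begin

lemma measurable_section:
  assumes "x \<in> space (PiM J M)"
  shows "(\<lambda>y. f (x(i := y))) \<in> borel_measurable (M i)"
  by (rule measurable_compose[OF measurable_component_update[OF assms J(2)] f])

lemma section_diff_le:
  assumes x: "x \<in> space (PiM J M)" and "y \<in> space (M i)" "z \<in> space (M i)"
  shows "f (x(i := y)) - f (x(i := z)) \<le> c i"
  using bounded_differencesD[OF diff fun_upd_in_space_PiM_insert[OF x assms(3)] _ assms(2)]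
  by (simp add: abs_le_iff)

lemma integrable_section:
  assumes x: "x \<in> space (PiM J M)"
  shows "integrable (M i) (\<lambda>y. f (x(i := y)))"
proof -
  obtain z where z: "z \<in> space (M i)" using M.not_empty by blast
  have "norm (f (x(i := y))) \<le> \<bar>f (x(i := z))\<bar> + c i" if "y \<in> space (M i)" for y
    using section_diff_le[OF x that z] section_diff_le[OF x z that] by simp
  then show ?thesis
    using measurable_section[OF x]
    by (intro M.integrable_const_bound[where B = "\<bar>f (x(i := z))\<bar> + c i"]) auto
qed

lemma measurable_marginal: "(\<lambda>x. \<integral>y. f (x(i := y)) \<partial>M i) \<in> borel_measurable (PiM J M)"
proof -
  have "(\<lambda>(x, y). f (x(i := y))) \<in> borel_measurable (PiM J M \<Otimes>\<^sub>M M i)"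
    by measurable
  then show ?thesis by measurable
qed

lemma integral_marginal:
  "(\<integral>x. \<integral>y. f (x(i := y)) \<partial>M i \<partial>PiM J M) = integral\<^sup>L (PiM (insert i J) M) f"
  using product_integral_insert[OF J integrable_if_bounded_differences[OF _ f diff]] J(1) by simp

lemma bounded_differences_marginal:
  "bounded_differences J M c (\<lambda>x. \<integral>y. f (x(i := y)) \<partial>M i)"
  unfolding bounded_differences_def
proof (intro ballI)
  fix x j z assume x: "x \<in> space (PiM J M)" and j: "j \<in> J" and z: "z \<in> space (M j)"
  have ne: "j \<noteq> i" using j J by auto
  have x': "x(j := z) \<in> space (PiM J M)"
    by (rule fun_upd_in_space_PiM[OF x j z])
  have pointwise: "\<bar>f (x(j := z, i := y)) - f (x(i := y))\<bar> \<le> c j" if "y \<in> space (M i)" for y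
    using bounded_differencesD[OF diff fun_upd_in_space_PiM_insert[OF x that] _ z] j
    by (simp add: fun_upd_twist[OF ne])
  have "\<bar>(\<integral>y. f (x(j := z, i := y)) \<partial>M i) - (\<integral>y. f (x(i := y)) \<partial>M i)\<bar>
      = \<bar>\<integral>y. f (x(j := z, i := y)) - f (x(i := y)) \<partial>M i\<bar>"
    by (simp add: integrable_section x x')
  also have "\<dots> \<le> (\<integral>y. \<bar>f (x(j := z, i := y)) - f (x(i := y))\<bar> \<partial>M i)"
    by (rule integral_abs_bound)
  also have "\<dots> \<le> c j"
    using pointwise by (intro M.integral_le_const)
      (auto intro!: integrable_abs Bochner_Integration.integrable_diff integrable_section x x')
  finally show "\<bar>(\<integral>y. f (x(j := z, i := y)) \<partial>M i) - (\<integral>y. f (x(i := y)) \<partial>M i)\<bar> \<le> c j" .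
qed

lemma nn_integral_exp_insert_le:
  assumes l: "l > 0"
  shows "(\<integral>\<^sup>+x. ennreal (exp (l * (f x - a))) \<partial>PiM (insert i J) M)
     \<le> ennreal (exp (l\<^sup>2 * (c i)\<^sup>2 / 8)) *
       (\<integral>\<^sup>+x. ennreal (exp (l * ((\<integral>y. f (x(i := y)) \<partial>M i) - a))) \<partial>PiM J M)"
proof -
  let ?g = "\<lambda>x. \<integral>y. f (x(i := y)) \<partial>M i"
  note [measurable] = measurable_marginal
  have "(\<integral>\<^sup>+x. ennreal (exp (l * (f x - a))) \<partial>PiM (insert i J) M)
      = (\<integral>\<^sup>+x. \<integral>\<^sup>+y. ennreal (exp (l * (f (x(i := y)) - a))) \<partial>M i \<partial>PiM J M)"
    by (rule product_nn_integral_insert[OF J]) measurable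
  also have "\<dots> \<le> (\<integral>\<^sup>+x. ennreal (exp (l\<^sup>2 * (c i)\<^sup>2 / 8)) * ennreal (exp (l * (?g x - a))) \<partial>PiM J M)"
  proof (rule nn_integral_mono)
    fix x assume x: "x \<in> space (PiM J M)"
    note [measurable] = measurable_section[OF x]
    have "(\<integral>\<^sup>+y. ennreal (exp (l * (f (x(i := y)) - a))) \<partial>M i)
        = (\<integral>\<^sup>+y. ennreal (exp (l * (f (x(i := y)) - ?g x))) * ennreal (exp (l * (?g x - a))) \<partial>M i)"
      by (simp add: algebra_simps flip: ennreal_mult exp_add)
    also have "\<dots> = (\<integral>\<^sup>+y. ennreal (exp (l * (f (x(i := y)) - ?g x))) \<partial>M i) * ennreal (exp (l * (?g x - a)))"
      by (rule nn_integral_multc) measurable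
    also have "\<dots> \<le> ennreal (exp (l\<^sup>2 * (c i)\<^sup>2 / 8)) * ennreal (exp (l * (?g x - a)))"
      by (intro mult_right_mono M.nn_integral_exp_le_if_oscillation_le l section_diff_le x) simp_all
    finally show "(\<integral>\<^sup>+y. ennreal (exp (l * (f (x(i := y)) - a))) \<partial>M i) \<le> \<dots>" .
  qed
  also have "\<dots> = ennreal (exp (l\<^sup>2 * (c i)\<^sup>2 / 8)) * (\<integral>\<^sup>+x. ennreal (exp (l * (?g x - a))) \<partial>PiM J M)"
    by (rule nn_integral_cmult) measurable
  finally show ?thesis .
qed

end

lemma nn_integral_exp_le_if_bounded_differences:
  assumes "finite J" and l: "l > 0"
    and "f \<in> borel_measurable (PiM J M)" "bounded_differences J M c f"
  shows "(\<integral>\<^sup>+x. ennreal (exp (l * (f x - integral\<^sup>L (PiM J M) f))) \<partial>PiM J M)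
           \<le> ennreal (exp (l\<^sup>2 * (\<Sum>i\<in>J. (c i)\<^sup>2) / 8))"
  using assms(1,3,4)
proof (induction J arbitrary: f rule: finite_induct)
  case empty
  show ?case
    by (simp add: PiM_empty nn_integral_count_space_finite lebesgue_integral_count_space_finite)
next
  case (insert i J)
  let ?g = "\<lambda>x. \<integral>y. f (x(i := y)) \<partial>M i"
  have "(\<integral>\<^sup>+x. ennreal (exp (l * (f x - integral\<^sup>L (PiM (insert i J) M) f))) \<partial>PiM (insert i J) M)
      \<le> ennreal (exp (l\<^sup>2 * (c i)\<^sup>2 / 8)) *
        (\<integral>\<^sup>+x. ennreal (exp (l * (?g x - integral\<^sup>L (PiM J M) ?g))) \<partial>PiM J M)"
    unfolding integral_marginal[OF insert.hyps insert.prems]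
    by (rule nn_integral_exp_insert_le[OF insert.hyps insert.prems l])
  also have "\<dots> \<le> ennreal (exp (l\<^sup>2 * (c i)\<^sup>2 / 8)) * ennreal (exp (l\<^sup>2 * (\<Sum>i\<in>J. (c i)\<^sup>2) / 8))"
    by (intro mult_left_mono insert.IH measurable_marginal[OF insert.hyps insert.prems]
          bounded_differences_marginal[OF insert.hyps insert.prems]) simp
  also have "\<dots> = ennreal (exp (l\<^sup>2 * (\<Sum>i\<in>insert i J. (c i)\<^sup>2) / 8))"
    using insert.hyps by (simp add: algebra_simps add_divide_distrib flip: ennreal_mult exp_add)
  finally show ?case .
qed

end

theorem (in finite_product_prob_space) McDiarmid_ineq_le:
  assumes f [measurable]: "f \<in> borel_measurable (PiM I M)"
    and diff: "bounded_differences I M c f"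
    and t: "t \<ge> 0" and S: "(\<Sum>i\<in>I. (c i)\<^sup>2) \<le> S" "S > 0"
  shows "prob {x \<in> space (PiM I M). f x \<le> expectation f - t} \<le> exp (- 2 * t\<^sup>2 / S)"
proof (cases "t = 0")
  case True
  then show ?thesis by simp
next
  case False
  define l where "l = 4 * t / S"
  have l: "l > 0" using t False S by (simp add: l_def)
  let ?P = "PiM I M"
  have "emeasure ?P {x \<in> space ?P. f x \<le> expectation f - t}
      = emeasure ?P {x \<in> space ?P. t \<le> expectation f - f x}"
    by (rule arg_cong[where f = "emeasure ?P"]) auto
  also have "\<dots> \<le> ennreal (exp (- l * t)) *
      (\<integral>\<^sup>+x. ennreal (exp (l * (expectation f - f x))) * indicator (space ?P) x \<partial>?P)"
    by (intro Chernoff_ineq_nn_integral_ge l) measurable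
  also have "(\<integral>\<^sup>+x. ennreal (exp (l * (expectation f - f x))) * indicator (space ?P) x \<partial>?P)
      = (\<integral>\<^sup>+x. ennreal (exp (l * (- f x - expectation (\<lambda>x. - f x)))) \<partial>?P)"
    by (intro nn_integral_cong) auto
  also have "\<dots> \<le> ennreal (exp (l\<^sup>2 * (\<Sum>i\<in>I. (c i)\<^sup>2) / 8))"
    by (intro nn_integral_exp_le_if_bounded_differences l finite_index bounded_differences_uminus diff)
       measurable
  also have "\<dots> \<le> ennreal (exp (l\<^sup>2 * S / 8))"
    using S by (intro ennreal_leI) (simp add: mult_left_mono)
  also have "ennreal (exp (- l * t)) * \<dots> = ennreal (exp (- 2 * t\<^sup>2 / S))"
    using S by (simp add: l_def field_simps power2_eq_square flip: ennreal_mult exp_add)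
  finally show ?thesis
    by (simp add: emeasure_eq_measure mult_left_mono)
qed

section \<open>Counting independent events\<close>

lemma (in prob_space) prob_card_indep_vars_ge:
  assumes indep: "indep_vars N X I" and "finite I"
    and A: "\<And>i. i \<in> I \<Longrightarrow> A i \<in> sets (N i)"
    and q: "\<And>i. i \<in> I \<Longrightarrow> q \<le> prob {x \<in> space M. X i x \<in> A i}" and t: "t > 0"
  shows "prob {x \<in> space M. real (card I) * (q - t) \<le> real (card {i\<in>I. X i x \<in> A i})}
           \<ge> 1 - exp (- 2 * real (card I) * t\<^sup>2)"
proof (cases "I = {}")
  case True
  then show ?thesis by simp
next
  case False
  with \<open>finite I\<close> have card_pos: "card I > 0" by (simp add: card_gt_0_iff)
  define Y where "Y = (\<lambda>i x. indicator (A i) (X i x) :: real)"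
  have sum_Y: "(\<Sum>i\<in>I. Y i x) = real (card {i\<in>I. X i x \<in> A i})" for x
    using \<open>finite I\<close> by (simp add: Y_def indicator_def sum.If_cases Int_def)
  interpret Y: Hoeffding_ineq M I Y "\<lambda>_. 0" "\<lambda>_. 1" "\<Sum>i\<in>I. expectation (Y i)"
  proof unfold_locales
    show "indep_vars (\<lambda>_. borel) Y I"
      unfolding Y_def by (rule indep_vars_compose2[OF indep]) (use A in measurable)
  qed (auto simp: \<open>finite I\<close> Y_def indicator_def)
  have "expectation (Y i) \<ge> q" if i: "i \<in> I" for i
  proof -
    have "expectation (Y i) = expectation (indicator {x \<in> space M. X i x \<in> A i})"
      by (rule Bochner_Integration.integral_cong) (auto simp: Y_def indicator_def)
    then show ?thesis
      using q[OF i] by (simp add: Int_absorb2)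
  qed
  then have mean: "real (card I) * q \<le> (\<Sum>i\<in>I. expectation (Y i))"
    using sum_mono[of I "\<lambda>_. q"] by simp
  have "1 - exp (- 2 * real (card I) * t\<^sup>2)
      = 1 - exp (- 2 * (real (card I) * t)\<^sup>2 / (\<Sum>i\<in>I. (1 - 0)\<^sup>2))"
    using card_pos by (simp add: power2_eq_square)
  also have "\<dots> \<le> 1 - prob {x \<in> space M. (\<Sum>i\<in>I. Y i x) \<le> (\<Sum>i\<in>I. expectation (Y i)) - real (card I) * t}"
    using Y.Hoeffding_ineq_le[of "real (card I) * t"] t card_pos by simp
  also have "\<dots> = prob {x \<in> space M. \<not> (\<Sum>i\<in>I. Y i x) \<le> (\<Sum>i\<in>I. expectation (Y i)) - real (card I) * t}"
    by (rule prob_neg[symmetric]) (auto intro!: borel_measurable_sum)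
  also have "\<dots> \<le> prob {x \<in> space M. real (card I) * (q - t) \<le> (\<Sum>i\<in>I. Y i x)}"
    using mean by (intro finite_measure_mono) (auto simp: right_diff_distrib intro!: borel_measurable_sum)
  finally show ?thesis by (simp add: sum_Y)
qed

corollary (in finite_product_prob_space) prob_card_components_ge:
  assumes A: "\<And>i. i \<in> I \<Longrightarrow> A i \<in> sets (M i)"
    and q: "\<And>i. i \<in> I \<Longrightarrow> q \<le> measure (M i) (A i)" and t: "t > 0"
  shows "1 - exp (- 2 * real (card I) * t\<^sup>2)
           \<le> prob {x \<in> space (PiM I M). real (card I) * (q - t) \<le> real (card {i\<in>I. x i \<in> A i})}"
proof (rule prob_card_indep_vars_ge[OF indep_vars_PiM_components finite_index A _ t])
  fix i assume i: "i \<in> I"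
  have "measure (M i) (A i) = measure (distr (PiM I M) (M i) (\<lambda>x. x i)) (A i)"
    by (simp add: PiM_component[OF i])
  also have "\<dots> = prob {x \<in> space (PiM I M). x i \<in> A i}"
    using i A by (subst measure_distr) (auto intro!: arg_cong[where f = prob])
  finally show "q \<le> prob {x \<in> space (PiM I M). x i \<in> A i}"
    using q[OF i] by simp
qed

corollary prob_Pi_pmf_card_ge:
  assumes "finite I" "J \<subseteq> I"
    and q: "\<And>i. i \<in> J \<Longrightarrow> q \<le> measure_pmf.prob (\<mu> i) (A i)" and t: "t > 0"
  shows "1 - exp (- 2 * real (card J) * t\<^sup>2)
           \<le> measure_pmf.prob (Pi_pmf I dflt \<mu>)
               {f. real (card J) * (q - t) \<le> real (card {i\<in>J. f i \<in> A i})}"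
proof -
  let ?P = "Pi_pmf I dflt \<mu>"
  have indep: "prob_space.indep_vars ?P (\<lambda>_. count_space UNIV) (\<lambda>i f. f i) J"
    by (rule prob_space.indep_vars_subset[OF measure_pmf.prob_space_axioms indep_vars_Pi_pmf]) fact+
  have "q \<le> measure_pmf.prob ?P {f \<in> space ?P. f i \<in> A i}" if i: "i \<in> J" for i
  proof -
    have "\<mu> i = map_pmf (\<lambda>f. f i) ?P"
      using assms(1,2) i by (subst Pi_pmf_component) auto
    then have "measure_pmf.prob (\<mu> i) (A i) = measure_pmf.prob ?P {f. f i \<in> A i}"
      by (simp add: vimage_def)
    then show ?thesis using q[OF i] by simp
  qed
  then show ?thesis
    using measure_pmf.prob_card_indep_vars_ge[OF indep finite_subset[OF assms(2,1)] _ _ t, of A q] by simp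
qed

section \<open>Occupying prescribed cells\<close>

definition arrangements :: "nat \<Rightarrow> 'i set \<Rightarrow> 'i list set" where
  "arrangements k I = {vs. length vs = k \<and> distinct vs \<and> set vs \<subseteq> I}"

lemma finite_arrangements: "finite I \<Longrightarrow> finite (arrangements k I)"
  unfolding arrangements_def
  by (rule finite_subset[OF _ finite_lists_length_eq[of I k]]) auto

lemma card_arrangements_ge:
  assumes "finite I" "k \<le> card I"
  shows "(real (card I - k + 1)) ^ k \<le> real (card (arrangements k I))"
proof -
  have "(real (card I - k + 1)) ^ k = (\<Prod>i\<in>{card I - k + 1..card I}. real (card I - k + 1))"
    using assms(2) by simp
  also have "\<dots> \<le> (\<Prod>i\<in>{card I - k + 1..card I}. real i)"
    by (rule prod_mono) auto
  also have "\<dots> = real (card (arrangements k I))"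
    unfolding arrangements_def card_lists_distinct_length_eq[OF assms] by simp
  finally show ?thesis .
qed

definition occupies_cells ::
  "('i \<Rightarrow> nat \<Rightarrow> 'a set) \<Rightarrow> ('i \<Rightarrow> 'a set) \<Rightarrow> 'i set \<Rightarrow> ('i \<Rightarrow> 'a) \<Rightarrow> 'i list \<Rightarrow> bool" where
  "occupies_cells A C I x vs \<longleftrightarrow>
     (\<forall>j<length vs. x (vs ! j) \<in> A (vs ! j) j) \<and> (\<forall>i\<in>I - set vs. x i \<notin> C i)"

locale cell_partition = finite_product_prob_space M I for M :: "'i \<Rightarrow> 'a measure" and I +
  fixes k :: nat and A :: "'i \<Rightarrow> nat \<Rightarrow> 'a set" and C :: "'i \<Rightarrow> 'a set"
  assumes cell_sets: "i \<in> I \<Longrightarrow> j < k \<Longrightarrow> A i j \<in> sets (M i)"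
    and union_sets: "i \<in> I \<Longrightarrow> C i \<in> sets (M i)"
    and cell_subset: "i \<in> I \<Longrightarrow> j < k \<Longrightarrow> A i j \<subseteq> C i"
    and cells_disjoint: "i \<in> I \<Longrightarrow> j < k \<Longrightarrow> l < k \<Longrightarrow> j \<noteq> l \<Longrightarrow> A i j \<inter> A i l = {}"
begin

definition cell_box :: "'i list \<Rightarrow> 'i \<Rightarrow> 'a set" where
  "cell_box vs i =
     (if i \<in> set vs then A i (inv_into {..<length vs} ((!) vs) i) else space (M i) - C i)"

lemma cell_box_nth:
  assumes "vs \<in> arrangements k I" "j < k"
  shows "cell_box vs (vs ! j) = A (vs ! j) j"
  using assms by (auto simp: cell_box_def arrangements_def inj_on_nth inv_into_f_f)

lemma cell_box_sets:
  assumes vs: "vs \<in> arrangements k I" and "i \<in> I"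
  shows "cell_box vs i \<in> sets (M i)"
proof (cases "i \<in> set vs")
  case True
  then obtain j where "j < k" "i = vs ! j"
    using vs by (auto simp: arrangements_def in_set_conv_nth)
  then show ?thesis using cell_sets[OF \<open>i \<in> I\<close>] cell_box_nth[OF vs] by auto
next
  case False
  then show ?thesis using union_sets[OF \<open>i \<in> I\<close>] by (auto simp: cell_box_def)
qed

lemma Collect_occupies_cells_eq:
  assumes vs: "vs \<in> arrangements k I"
  shows "{x \<in> space (PiM I M). occupies_cells A C I x vs} = PiE I (cell_box vs)"
proof (intro set_eqI iffI)
  fix x assume x: "x \<in> {x \<in> space (PiM I M). occupies_cells A C I x vs}"
  have "x i \<in> cell_box vs i" if "i \<in> I" for i
  proof (cases "i \<in> set vs")
    case True
    then obtain j where "j < k" "i = vs ! j"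
      using vs by (auto simp: arrangements_def in_set_conv_nth)
    then show ?thesis
      using x vs by (simp add: cell_box_nth[OF vs] occupies_cells_def arrangements_def)
  next
    case False
    then show ?thesis
      using x that by (auto simp: cell_box_def occupies_cells_def space_PiM)
  qed
  then show "x \<in> PiE I (cell_box vs)"
    using x by (auto simp: space_PiM PiE_iff)
next
  fix x assume x: "x \<in> PiE I (cell_box vs)"
  have "x (vs ! j) \<in> A (vs ! j) j" if "j < length vs" for j
    using vs x that cell_box_nth[OF vs, of j] nth_mem[OF that]
    by (auto simp: PiE_iff arrangements_def subset_iff)
  moreover have "x i \<notin> C i" if "i \<in> I" "i \<notin> set vs" for i
    using x that by (auto simp: cell_box_def PiE_iff dest!: bspec[of _ _ i])
  moreover have "x \<in> space (PiM I M)"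
    using x sets.sets_into_space[OF cell_box_sets[OF vs]] by (fastforce simp: space_PiM PiE_iff)
  ultimately show "x \<in> {x \<in> space (PiM I M). occupies_cells A C I x vs}"
    by (simp add: occupies_cells_def)
qed

lemma Collect_occupies_cells_sets:
  "vs \<in> arrangements k I \<Longrightarrow> {x \<in> space (PiM I M). occupies_cells A C I x vs} \<in> events"
  by (simp add: Collect_occupies_cells_eq sets_PiM_I_finite finite_index cell_box_sets)

lemma prob_occupies_cells_ge:
  assumes vs: "vs \<in> arrangements k I"
    and a: "0 \<le> a" "\<And>i j. i \<in> I \<Longrightarrow> j < k \<Longrightarrow> a \<le> measure (M i) (A i j)"
  shows "a ^ k * (1 - (\<Sum>i\<in>I. measure (M i) (C i)))
           \<le> prob {x \<in> space (PiM I M). occupies_cells A C I x vs}"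
proof -
  let ?a = "\<lambda>i. if i \<in> set vs then a else 1"
  have "(\<Prod>i\<in>I. ?a i) = (\<Prod>i\<in>I \<inter> set vs. a)"
    by (rule prod.inter_restrict[symmetric, OF finite_index])
  then have a_power: "a ^ k = (\<Prod>i\<in>I. ?a i)"
    using vs by (simp add: Int_absorb1 arrangements_def distinct_card)
  have "a ^ k * (1 - (\<Sum>i\<in>I. measure (M i) (C i))) \<le> a ^ k * (\<Prod>i\<in>I. 1 - measure (M i) (C i))"
    using a(1) by (intro mult_left_mono Weierstrass_prod_ineq) auto
  also have "\<dots> = (\<Prod>i\<in>I. ?a i * (1 - measure (M i) (C i)))"
    by (simp add: a_power prod.distrib)
  also have "\<dots> \<le> (\<Prod>i\<in>I. measure (M i) (cell_box vs i))"
  proof (intro prod_mono conjI)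
    fix i assume i: "i \<in> I"
    show "0 \<le> ?a i * (1 - measure (M i) (C i))" using a(1) by simp
    show "?a i * (1 - measure (M i) (C i)) \<le> measure (M i) (cell_box vs i)"
    proof (cases "i \<in> set vs")
      case True
      then obtain j where j: "j < k" "i = vs ! j"
        using vs by (auto simp: arrangements_def in_set_conv_nth)
      have "a * (1 - measure (M i) (C i)) \<le> a"
        using a(1) by (intro mult_left_le) auto
      also have "\<dots> \<le> measure (M i) (cell_box vs i)"
        using a(2)[OF i j(1)] cell_box_nth[OF vs j(1)] j(2) by simp
      finally show ?thesis using True by simp
    next
      case False
      then show ?thesis using M.prob_compl[OF union_sets[OF i]] by (simp add: cell_box_def)
    qed
  qed
  also have "\<dots> = prob {x \<in> space (PiM I M). occupies_cells A C I x vs}"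
    by (simp add: Collect_occupies_cells_eq[OF vs] finite_measure_PiM_emb cell_box_sets[OF vs])
  finally show ?thesis .
qed

lemma occupies_cells_unique:
  assumes vs: "vs \<in> arrangements k I" "occupies_cells A C I x vs"
    and us: "us \<in> arrangements k I" "occupies_cells A C I x us"
  shows "vs = us"
proof (rule nth_equalityI)
  show "length vs = length us" using vs us by (simp add: arrangements_def)
  fix j assume "j < length vs"
  then have j: "j < k" using vs by (simp add: arrangements_def)
  have vj: "vs ! j \<in> I" "x (vs ! j) \<in> A (vs ! j) j"
    using vs j by (auto simp: arrangements_def occupies_cells_def)
  then have "x (vs ! j) \<in> C (vs ! j)" using cell_subset j by auto
  then have "vs ! j \<in> set us"
    using us vj(1) by (auto simp: occupies_cells_def)
  then obtain l where l: "l < k" "us ! l = vs ! j"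
    using us by (auto simp: in_set_conv_nth arrangements_def)
  then have "x (vs ! j) \<in> A (vs ! j) l"
    using us by (auto simp: occupies_cells_def arrangements_def)
  then have "l = j"
    using cells_disjoint[OF vj(1) j l(1)] vj(2) by auto
  then show "vs ! j = us ! j" using l by simp
qed

lemma prob_ex_occupies_cells_ge:
  assumes a: "0 \<le> a" "\<And>i j. i \<in> I \<Longrightarrow> j < k \<Longrightarrow> a \<le> measure (M i) (A i j)"
  shows "real (card (arrangements k I)) * (a ^ k * (1 - (\<Sum>i\<in>I. measure (M i) (C i))))
           \<le> prob {x \<in> space (PiM I M). \<exists>vs\<in>arrangements k I. occupies_cells A C I x vs}"
proof -
  let ?E = "\<lambda>vs. {x \<in> space (PiM I M). occupies_cells A C I x vs}"
  have "real (card (arrangements k I)) * (a ^ k * (1 - (\<Sum>i\<in>I. measure (M i) (C i))))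
      \<le> (\<Sum>vs\<in>arrangements k I. prob (?E vs))"
    by (rule sum_bounded_below) (rule prob_occupies_cells_ge[OF _ a])
  also have "\<dots> = prob (\<Union>vs\<in>arrangements k I. ?E vs)"
    by (rule finite_measure_finite_Union[symmetric])
       (use occupies_cells_unique Collect_occupies_cells_sets in
         \<open>auto simp: finite_arrangements finite_index disjoint_family_on_def\<close>)
  also have "(\<Union>vs\<in>arrangements k I. ?E vs)
      = {x \<in> space (PiM I M). \<exists>vs\<in>arrangements k I. occupies_cells A C I x vs}"
    by auto
  finally show ?thesis .
qed

end

section \<open>Drawing without repetition\<close>

lemma pmf_weighted_pmf:
  assumes "finite S" and pos: "\<And>v. v \<in> S \<Longrightarrow> f v > 0" and "v \<in> S"
  shows "pmf (weighted_pmf S f) v = f v / (\<Sum>u\<in>S. f u)"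
proof -
  have sum_pos: "(\<Sum>u\<in>S. f u) > 0" using assms by (intro sum_pos) auto
  have "(\<integral>\<^sup>+u. ennreal (if u \<in> S then f u / (\<Sum>u\<in>S. f u) else 0) \<partial>count_space UNIV)
      = (\<Sum>u\<in>S. ennreal (f u / (\<Sum>u\<in>S. f u)))"
    by (subst nn_integral_count_space'[OF assms(1)]) (auto intro!: sum.cong)
  also have "\<dots> = ennreal (\<Sum>u\<in>S. f u / (\<Sum>u\<in>S. f u))"
    using pos sum_pos by (intro sum_ennreal) (auto intro!: divide_nonneg_pos less_imp_le)
  also have "\<dots> = 1" using sum_pos by (simp flip: sum_divide_distrib)
  finally have total: "(\<integral>\<^sup>+u. ennreal (if u \<in> S then f u / (\<Sum>u\<in>S. f u) else 0) \<partial>count_space UNIV) = 1" .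
  show ?thesis
    unfolding weighted_pmf_def
    by (subst pmf_embed_pmf[OF _ total])
       (use assms sum_pos in \<open>auto intro!: divide_nonneg_pos less_imp_le\<close>)
qed

lemma pmf_draw_seq_Cons:
  "pmf (draw_seq f S (Suc j)) (v # vs) = pmf (weighted_pmf S f) v * pmf (draw_seq f (S - {v}) j) vs"
proof -
  have pmf_Cons: "pmf (map_pmf ((#) u) (draw_seq f (S - {u}) j)) (v # vs)
      = indicator {v} u * pmf (draw_seq f (S - {v}) j) vs" for u
    by (cases "u = v") (auto simp: pmf_map_inj' pmf_eq_0_set_pmf)
  have "pmf (draw_seq f S (Suc j)) (v # vs)
      = (\<integral>u. pmf (map_pmf ((#) u) (draw_seq f (S - {u}) j)) (v # vs) \<partial>weighted_pmf S f)"
    by (simp add: pmf_bind map_pmf_def)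
  also have "\<dots> = pmf (weighted_pmf S f) v * pmf (draw_seq f (S - {v}) j) vs"
    by (simp only: pmf_Cons) (simp add: pmf.rep_eq)
  finally show ?thesis .
qed

lemma pmf_draw_seq:
  assumes "finite S" "\<And>v. v \<in> S \<Longrightarrow> f v > 0" "distinct vs" "set vs \<subseteq> S"
  shows "pmf (draw_seq f S (length vs)) vs
           = (\<Prod>j<length vs. f (vs ! j) / (\<Sum>u\<in>S - set (take j vs). f u))"
  using assms
proof (induction vs arbitrary: S)
  case Nil
  then show ?case by simp
next
  case (Cons v vs)
  have "pmf (draw_seq f S (length (v # vs))) (v # vs)
      = f v / (\<Sum>u\<in>S. f u) * pmf (draw_seq f (S - {v}) (length vs)) vs"
    using Cons.prems by (simp add: pmf_draw_seq_Cons pmf_weighted_pmf del: draw_seq.simps)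
  also have "pmf (draw_seq f (S - {v}) (length vs)) vs
      = (\<Prod>j<length vs. f (vs ! j) / (\<Sum>u\<in>S - {v} - set (take j vs). f u))"
    using Cons.prems by (intro Cons.IH) auto
  also have "f v / (\<Sum>u\<in>S. f u) * \<dots>
      = (\<Prod>j<length (v # vs). f ((v # vs) ! j) / (\<Sum>u\<in>S - set (take j (v # vs)). f u))"
    by (simp add: prod.lessThan_Suc_shift Diff_insert2[of S v "set (take j vs)" for j] del: prod.lessThan_Suc)
  finally show ?case .
qed

lemma nice_clauseI:
  assumes sorted: "sorted_wrt (\<lambda>u v. X v < X u) vs"
    and outside: "\<And>u v. u \<in> set vs \<Longrightarrow> v < n \<Longrightarrow> v \<notin> set vs \<Longrightarrow> X v < X u"
  shows "nice_clause n X vs"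
  unfolding nice_clause_def
proof (intro allI impI)
  fix j v assume j: "j < length vs" and v: "v < n" "v \<notin> set (take (Suc j) vs)"
  show "X v < X (vs ! j)"
  proof (cases "v \<in> set vs")
    case True
    then obtain i where i: "i < length vs" "v = vs ! i" by (auto simp: in_set_conv_nth)
    then have "\<not> i < Suc j" using v(2) by (auto simp: in_set_conv_nth)
    then show ?thesis using sorted_wrt_nth_less[OF sorted, of j i] i by simp
  next
    case False
    then show ?thesis using outside j v(1) by simp
  qed
qed

lemma sum_undrawn_le:
  fixes X :: "nat \<Rightarrow> real"
  assumes vs: "vs \<in> arrangements k {..<n}" and sorted: "sorted_wrt (\<lambda>u v. X v < X u) vs"
    and j: "j < k" and nonneg: "0 \<le> X (vs ! j)"
    and tail: "(\<Sum>v\<in>{..<n} - set vs. X v) \<le> K * X (vs ! j)"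
  shows "(\<Sum>v\<in>{..<n} - set (take j vs). X v) \<le> (real k + K) * X (vs ! j)"
proof -
  have len: "length vs = k" and dist: "distinct vs" and sub: "set vs \<subseteq> {..<n}"
    using vs by (auto simp: arrangements_def)
  have disj: "set (take j vs) \<inter> set (drop j vs) = {}"
    using dist by (rule set_take_disj_set_drop_if_distinct) simp
  have union: "set vs = set (take j vs) \<union> set (drop j vs)"
    by (simp flip: set_append)
  have "{..<n} - set (take j vs) = set (drop j vs) \<union> ({..<n} - set vs)"
    using sub disj by (auto simp: union)
  then have "(\<Sum>v\<in>{..<n} - set (take j vs). X v) = (\<Sum>v\<in>set (drop j vs). X v) + (\<Sum>v\<in>{..<n} - set vs. X v)"
    by (simp add: union sum.union_disjoint disjoint_iff)
  also have "(\<Sum>v\<in>set (drop j vs). X v) \<le> real (card (set (drop j vs))) * X (vs ! j)"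
  proof (rule sum_bounded_above)
    fix v assume "v \<in> set (drop j vs)"
    then obtain i where "i < length (drop j vs)" "v = drop j vs ! i"
      by (metis in_set_conv_nth)
    then have i: "j + i < length vs" "v = vs ! (j + i)" by auto
    then show "X v \<le> X (vs ! j)"
      using sorted_wrt_nth_less[OF sorted, of j "j + i"] by (cases "i = 0") auto
  qed
  also have "\<dots> \<le> real k * X (vs ! j)"
    using nonneg len card_length[of "drop j vs"] by (intro mult_right_mono) auto
  finally show ?thesis using tail by (simp add: distrib_right)
qed

lemma prob_nice_clause_ge:
  fixes X :: "nat \<Rightarrow> real"
  assumes pos: "\<And>v. v < n \<Longrightarrow> 0 < X v" and vs: "vs \<in> arrangements k {..<n}"
    and sorted: "sorted_wrt (\<lambda>u v. X v < X u) vs"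
    and outside: "\<And>u v. u \<in> set vs \<Longrightarrow> v < n \<Longrightarrow> v \<notin> set vs \<Longrightarrow> X v < X u"
    and tail: "\<And>u. u \<in> set vs \<Longrightarrow> (\<Sum>v\<in>{..<n} - set vs. X v) \<le> K * X u" and K: "0 \<le> K"
  shows "(1 / (real k + K)) ^ k \<le> measure_pmf.prob (draw_seq X {..<n} k) {vs. nice_clause n X vs}"
proof -
  have len: "length vs = k" and dist: "distinct vs" and sub: "set vs \<subseteq> {..<n}"
    using vs by (auto simp: arrangements_def)
  have factor: "1 / (real k + K) \<le> X (vs ! j) / (\<Sum>v\<in>{..<n} - set (take j vs). X v)" if j: "j < k" for j
  proof -
    have vj: "vs ! j \<in> set vs" using j len by simp
    moreover have "vs ! j \<notin> set (take j vs)"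
      using j len dist by (auto simp: in_set_conv_nth nth_eq_iff_index_eq)
    ultimately have undrawn: "vs ! j \<in> {..<n} - set (take j vs)" using sub by auto
    have "0 < (\<Sum>v\<in>{..<n} - set (take j vs). X v)"
      using undrawn pos by (intro sum_pos) auto
    moreover have "(\<Sum>v\<in>{..<n} - set (take j vs). X v) \<le> (real k + K) * X (vs ! j)"
      using vj undrawn pos by (intro sum_undrawn_le[OF vs sorted j _ tail]) (auto intro: less_imp_le)
    ultimately show ?thesis using K j by (simp add: field_simps)
  qed
  have "(1 / (real k + K)) ^ k = (\<Prod>j<k. 1 / (real k + K))" by simp
  also have "\<dots> \<le> (\<Prod>j<k. X (vs ! j) / (\<Sum>v\<in>{..<n} - set (take j vs). X v))"
    using factor K by (intro prod_mono) auto
  also have "\<dots> = pmf (draw_seq X {..<n} k) vs"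
    using pmf_draw_seq[of "{..<n}" X vs] pos dist sub by (simp add: len)
  also have "\<dots> \<le> measure_pmf.prob (draw_seq X {..<n} k) {vs. nice_clause n X vs}"
    unfolding pmf.rep_eq using nice_clauseI[OF sorted outside]
    by (intro measure_pmf.finite_measure_mono) auto
  finally show ?thesis .
qed

section \<open>Balls in the torus\<close>

lemma prob_space_uniform_interval: "prob_space (uniform_measure lborel {0..<1::real})"
  by (rule prob_space_uniform_measure) auto

lemma measure_uniform_interval:
  assumes "B \<subseteq> {0..<1::real}" "B \<in> sets lborel"
  shows "measure (uniform_measure lborel {0..<1}) B = measure lborel B"
  using assms by (simp add: measure_uniform_measure Int_absorb1)

lemma circ_dist_measurable [measurable (raw)]:
  assumes [measurable]: "f \<in> borel_measurable M" "g \<in> borel_measurable M"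
  shows "(\<lambda>x. circ_dist (f x) (g x)) \<in> borel_measurable M"
  unfolding circ_dist_def by measurable

lemma circ_dist_commute: "circ_dist a b = circ_dist b a"
  unfolding circ_dist_def by (simp add: abs_minus_commute)

lemma circ_dist_nonneg: "a \<in> {0..<1} \<Longrightarrow> b \<in> {0..<1} \<Longrightarrow> 0 \<le> circ_dist a b"
  unfolding circ_dist_def by auto

lemma circ_ball_cases:
  assumes a: "a \<in> {0..<1}" and r: "0 \<le> r"
  obtains (whole) "1 / 2 \<le> r" "{b \<in> {0..<1}. circ_dist a b \<le> r} = {0..<1}"
  | (middle) "r < 1 / 2" "{b \<in> {0..<1}. circ_dist a b \<le> r} = {a - r..a + r}"
  | (left) "r < 1 / 2" "a < r" "{b \<in> {0..<1}. circ_dist a b \<le> r} = {0..a + r} \<union> {a - r + 1..<1}"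
  | (right) "r < 1 / 2" "1 - r \<le> a" "{b \<in> {0..<1}. circ_dist a b \<le> r} = {0..a + r - 1} \<union> {a - r..<1}"
proof -
  consider (large) "1 / 2 \<le> r" | (low) "r < 1 / 2" "a < r" | (high) "r < 1 / 2" "1 - r \<le> a"
    | (central) "r < 1 / 2" "r \<le> a" "a < 1 - r"
    by linarith
  then show thesis
  proof cases
    case large
    show thesis
      by (rule whole) (use a large in \<open>auto simp: circ_dist_def\<close>)
  next
    case low
    show thesis
      by (rule left) (use a low in \<open>auto simp: circ_dist_def min_le_iff_disj abs_le_iff abs_if\<close>)
  next
    case high
    show thesis
      by (rule right) (use a high in \<open>auto simp: circ_dist_def min_le_iff_disj abs_le_iff abs_if\<close>)
  next
    case central
    show thesis
      by (rule middle) (use a central in \<open>auto simp: circ_dist_def min_le_iff_disj abs_le_iff abs_if\<close>)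
  qed
qed

lemma measure_circ_ball:
  assumes a: "a \<in> {0..<1}" and r: "0 \<le> r"
  shows "measure (uniform_measure lborel {0..<1}) {b \<in> {0..<1}. circ_dist a b \<le> r} = min 1 (2 * r)"
proof -
  have "measure (uniform_measure lborel {0..<1}) {b \<in> {0..<1}. circ_dist a b \<le> r}
      = measure lborel {b \<in> {0..<1}. circ_dist a b \<le> r}"
    by (rule measure_uniform_interval) auto
  also have "\<dots> = min 1 (2 * r)"
    using a r
  proof (cases rule: circ_ball_cases)
    case left
    have "measure lborel ({0..a + r} \<union> {a - r + 1..<1})
        = measure lborel {0..a + r} + measure lborel {a - r + 1..<1}"
      using left(1,2) a r by (intro measure_Union) (auto simp: emeasure_lborel_Icc_eq)
    then show ?thesis unfolding left(3) using left(1,2) a r by simp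
  next
    case right
    have "measure lborel ({0..a + r - 1} \<union> {a - r..<1})
        = measure lborel {0..a + r - 1} + measure lborel {a - r..<1}"
      using right(1,2) a r by (intro measure_Union) (auto simp: emeasure_lborel_Icc_eq)
    then show ?thesis unfolding right(3) using right(1,2) a r by simp
  qed (use r in simp_all)
  finally show ?thesis .
qed

lemma prob_space_torus: "prob_space (torus_space d)"
  unfolding torus_space_def by (rule prob_space_PiM) (rule prob_space_uniform_interval)

lemma torus_component_measurable [measurable (raw)]:
  assumes "i < d" "f \<in> measurable M (torus_space d)"
  shows "(\<lambda>x. f x i) \<in> borel_measurable M"
proof -
  have "(\<lambda>y. y i) \<in> measurable (torus_space d) (uniform_measure lborel {0..<1::real})"
    unfolding torus_space_def by (rule measurable_component_singleton) (use assms(1) in simp)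
  then have "(\<lambda>y. y i) \<in> borel_measurable (torus_space d)"
    by (simp cong: measurable_cong_sets)
  from measurable_compose[OF assms(2) this] show ?thesis .
qed

lemma torus_dist_measurable [measurable (raw)]:
  assumes [measurable]: "f \<in> measurable M (torus_space d)" "g \<in> measurable M (torus_space d)"
  shows "(\<lambda>x. torus_dist p d (f x) (g x)) \<in> borel_measurable M"
proof (cases p)
  case (enat q)
  show ?thesis unfolding torus_dist_def enat by simp measurable
next
  case infinity
  show ?thesis unfolding torus_dist_def infinity by simp measurable
qed

definition unit_cube :: "nat \<Rightarrow> (nat \<Rightarrow> real) set" where
  "unit_cube d = ({..<d} \<rightarrow>\<^sub>E {0..<1})"

lemma unit_cube_component: "x \<in> unit_cube d \<Longrightarrow> i < d \<Longrightarrow> x i \<in> {0..<1}"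
  by (auto simp: unit_cube_def PiE_iff)

lemma unit_cube_sets [measurable]: "unit_cube d \<in> sets (torus_space d)"
  unfolding unit_cube_def torus_space_def by (rule sets_PiM_I_finite) auto

lemma unit_cube_in_space: "x \<in> unit_cube d \<Longrightarrow> x \<in> space (torus_space d)"
  using sets.sets_into_space[OF unit_cube_sets] by blast

lemma AE_unit_cube: "AE x in torus_space d. x \<in> unit_cube d"
proof -
  have "AE x in torus_space d. \<forall>i\<in>{..<d}. x i \<in> {0..<1}"
    unfolding torus_space_def
    by (intro AE_finite_allI AE_PiM_component AE_uniform_measureI)
       (auto intro: prob_space_uniform_interval)
  then show ?thesis
    by (rule AE_mp) (auto intro!: AE_I2 simp: unit_cube_def torus_space_def space_PiM PiE_iff)
qed

lemma torus_dist_commute: "torus_dist p d x y = torus_dist p d y x"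
  unfolding torus_dist_def by (cases p) (simp_all add: circ_dist_commute[of "x i" "y i" for i])

lemma power_powr_inverse: "c \<ge> 0 \<Longrightarrow> q \<ge> 1 \<Longrightarrow> (c ^ q) powr (1 / real q) = (c::real)"
  by (cases "c = 0") (auto simp: powr_powr simp flip: powr_realpow)

lemma powr_inverse_power: "c \<ge> 0 \<Longrightarrow> d \<ge> 1 \<Longrightarrow> (c powr (1 / real d)) ^ d = c"
  by (cases "c = 0") (simp_all add: powr_powr flip: powr_realpow)

lemma circ_dist_le_torus_dist:
  assumes i: "i < d" and x: "x \<in> unit_cube d" and y: "y \<in> unit_cube d" and p: "p \<ge> 1"
  shows "circ_dist (x i) (y i) \<le> torus_dist p d x y"
proof (cases p)
  case (enat q)
  have nonneg: "0 \<le> circ_dist (x j) (y j)" if "j < d" for j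
    using that x y by (intro circ_dist_nonneg unit_cube_component)
  have "circ_dist (x i) (y i) = (circ_dist (x i) (y i) ^ q) powr (1 / real q)"
    using nonneg[OF i] p enat by (simp add: power_powr_inverse one_enat_def)
  also have "\<dots> \<le> (\<Sum>i<d. circ_dist (x i) (y i) ^ q) powr (1 / real q)"
    by (intro powr_mono2 member_le_sum[of i "{..<d}" "\<lambda>i. circ_dist (x i) (y i) ^ q"])
       (use i nonneg in auto)
  finally show ?thesis by (simp add: torus_dist_def enat)
next
  case infinity
  then show ?thesis using i by (auto simp: torus_dist_def intro!: Max_ge)
qed

lemma torus_dist_nonneg:
  assumes "x \<in> unit_cube d" "y \<in> unit_cube d" "p \<ge> 1" "d \<ge> 1"
  shows "0 \<le> torus_dist p d x y"
proof -
  have "0 \<le> circ_dist (x 0) (y 0)"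
    using assms by (intro circ_dist_nonneg unit_cube_component) auto
  also have "\<dots> \<le> torus_dist p d x y"
    using assms by (intro circ_dist_le_torus_dist) auto
  finally show ?thesis .
qed

lemma torus_dist_le:
  assumes x: "x \<in> unit_cube d" and y: "y \<in> unit_cube d" and p: "p \<ge> 1" and d: "d \<ge> 1"
    and le: "\<And>i. i < d \<Longrightarrow> circ_dist (x i) (y i) \<le> r"
  shows "torus_dist p d x y \<le> real d * r"
proof -
  have nonneg: "0 \<le> circ_dist (x j) (y j)" if "j < d" for j
    using that x y by (intro circ_dist_nonneg unit_cube_component)
  have r: "0 \<le> r" using nonneg[of 0] le[of 0] d by simp
  show ?thesis
  proof (cases p)
    case (enat q)
    then have q: "q \<ge> 1" using p by (simp add: one_enat_def)
    have "(\<Sum>i<d. circ_dist (x i) (y i) ^ q) \<le> (\<Sum>i<d. r ^ q)"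
      by (intro sum_mono power_mono) (use nonneg le in auto)
    also have "\<dots> \<le> real d ^ q * r ^ q"
      using d q r by (simp add: mult_right_mono self_le_power)
    also have "\<dots> = (real d * r) ^ q" by (simp add: power_mult_distrib)
    finally have "(\<Sum>i<d. circ_dist (x i) (y i) ^ q) powr (1 / real q) \<le> ((real d * r) ^ q) powr (1 / real q)"
      by (intro powr_mono2) (use nonneg in \<open>auto intro!: sum_nonneg\<close>)
    also have "\<dots> = real d * r" using q r by (intro power_powr_inverse) auto
    finally show ?thesis by (simp add: torus_dist_def enat)
  next
    case infinity
    have "Max ((\<lambda>i. circ_dist (x i) (y i)) ` {..<d}) \<le> r"
      using d le by (subst Max_le_iff) (auto simp: lessThan_empty_iff)
    also have "r \<le> real d * r" using d r by (simp add: mult_le_cancel_right1)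
    finally show ?thesis by (simp add: torus_dist_def infinity)
  qed
qed

text \<open>
  Outside the unit cube \<open>circ_dist\<close> takes negative values. Such points form a null set, but the
  bounded difference property below is required for all points of the space; hence a ball around
  a point outside the cube is empty by definition.
\<close>

definition torus_ball :: "enat \<Rightarrow> nat \<Rightarrow> (nat \<Rightarrow> real) \<Rightarrow> real \<Rightarrow> (nat \<Rightarrow> real) set" where
  "torus_ball p d x r = {y \<in> unit_cube d. x \<in> unit_cube d \<and> torus_dist p d x y \<le> r}"

lemma torus_ball_measurable [measurable (raw)]:
  assumes [measurable]: "f \<in> measurable M (torus_space d)" "g \<in> measurable M (torus_space d)"
  shows "Measurable.pred M (\<lambda>z. g z \<in> torus_ball p d (f z) r)"
  unfolding torus_ball_def by measurable

lemma torus_ball_sets [measurable]: "torus_ball p d x r \<in> sets (torus_space d)"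
proof (cases "x \<in> unit_cube d")
  case True
  then have [measurable]: "x \<in> space (torus_space d)" by (rule unit_cube_in_space)
  have "torus_ball p d x r = {y \<in> space (torus_space d). y \<in> torus_ball p d x r}"
    by (auto simp: torus_ball_def unit_cube_in_space)
  also have "\<dots> \<in> sets (torus_space d)" by measurable
  finally show ?thesis .
qed (simp add: torus_ball_def)

lemma torus_ball_commute: "y \<in> torus_ball p d x r \<longleftrightarrow> x \<in> torus_ball p d y r"
  by (auto simp: torus_ball_def torus_dist_commute)

lemma torus_ball_mono: "r \<le> s \<Longrightarrow> torus_ball p d x r \<subseteq> torus_ball p d x s"
  by (auto simp: torus_ball_def)

definition torus_cube :: "nat \<Rightarrow> (nat \<Rightarrow> real) \<Rightarrow> real \<Rightarrow> (nat \<Rightarrow> real) set" where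
  "torus_cube d x r = (\<Pi>\<^sub>E i\<in>{..<d}. {b \<in> {0..<1}. circ_dist (x i) b \<le> r})"

lemma torus_cube_sets: "torus_cube d x r \<in> sets (torus_space d)"
  unfolding torus_cube_def torus_space_def by (rule sets_PiM_I_finite) auto

lemma measure_torus_cube:
  assumes "x \<in> unit_cube d" "0 \<le> r"
  shows "measure (torus_space d) (torus_cube d x r) = min 1 (2 * r) ^ d"
proof -
  interpret finite_product_prob_space "\<lambda>_. uniform_measure lborel {0..<1::real}" "{..<d}"
    by (intro finite_product_prob_spaceI prob_space_uniform_interval) simp
  have "measure (torus_space d) (torus_cube d x r)
      = (\<Prod>i<d. measure (uniform_measure lborel {0..<1}) {b \<in> {0..<1}. circ_dist (x i) b \<le> r})"
    unfolding torus_space_def torus_cube_def by (rule finite_measure_PiM_emb) auto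
  also have "\<dots> = (\<Prod>i<d. min 1 (2 * r))"
    using assms by (intro prod.cong measure_circ_ball unit_cube_component) auto
  finally show ?thesis by simp
qed

lemma torus_ball_subset_torus_cube:
  assumes "p \<ge> 1"
  shows "torus_ball p d x r \<subseteq> torus_cube d x r"
proof
  fix y assume y: "y \<in> torus_ball p d x r"
  then have "circ_dist (x i) (y i) \<le> r" if "i < d" for i
    using circ_dist_le_torus_dist[OF that _ _ assms, of x y] by (auto simp: torus_ball_def)
  then show "y \<in> torus_cube d x r"
    using y by (auto simp: torus_ball_def torus_cube_def unit_cube_def PiE_iff)
qed

lemma torus_cube_subset_torus_ball:
  assumes "p \<ge> 1" "d \<ge> 1" and x: "x \<in> unit_cube d"
  shows "torus_cube d x r \<subseteq> torus_ball p d x (real d * r)"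
proof
  fix y assume y: "y \<in> torus_cube d x r"
  then have "y \<in> unit_cube d" by (auto simp: torus_cube_def unit_cube_def PiE_iff)
  moreover from this have "torus_dist p d x y \<le> real d * r"
    using y assms by (intro torus_dist_le) (auto simp: torus_cube_def PiE_iff)
  ultimately show "y \<in> torus_ball p d x (real d * r)"
    using x by (simp add: torus_ball_def)
qed

lemma measure_torus_ball_le:
  assumes "p \<ge> 1" "0 \<le> r"
  shows "measure (torus_space d) (torus_ball p d x r) \<le> (2 * r) ^ d"
proof (cases "x \<in> unit_cube d")
  case False
  then show ?thesis using assms by (simp add: torus_ball_def)
next
  case True
  interpret prob_space "torus_space d" by (rule prob_space_torus)
  have "measure (torus_space d) (torus_ball p d x r) \<le> measure (torus_space d) (torus_cube d x r)"
    by (intro finite_measure_mono torus_ball_subset_torus_cube torus_cube_sets assms)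
  also have "\<dots> \<le> (2 * r) ^ d"
    unfolding measure_torus_cube[OF True assms(2)] using assms(2) by (intro power_mono) auto
  finally show ?thesis .
qed

lemma measure_torus_ball_ge:
  assumes "p \<ge> 1" "d \<ge> 1" "x \<in> unit_cube d" "0 \<le> r" "2 * r \<le> 1"
  shows "(2 * r) ^ d \<le> measure (torus_space d) (torus_ball p d x (real d * r))"
proof -
  interpret prob_space "torus_space d" by (rule prob_space_torus)
  have "(2 * r) ^ d = measure (torus_space d) (torus_cube d x r)"
    using assms by (simp add: measure_torus_cube)
  also have "\<dots> \<le> measure (torus_space d) (torus_ball p d x (real d * r))"
    by (intro finite_measure_mono torus_cube_subset_torus_ball torus_ball_sets assms)
  finally show ?thesis .
qed

text \<open>
  A \<open>p\<close>-norm ball is only sandwiched between two cubes whose sides differ by a factor \<open>d\<close>; with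
  ratio \<open>2d\<close> between the radii the inner cube of the larger ball beats the outer cube of the smaller.
\<close>

lemma measure_torus_shell_ge:
  assumes p: "p \<ge> 1" and d: "d \<ge> 1" and x: "x \<in> unit_cube d" and r: "0 \<le> r" "4 * r \<le> 1"
  shows "(2 * r) ^ d \<le> measure (torus_space d) (torus_ball p d x (2 * real d * r) - torus_ball p d x r)"
proof -
  interpret prob_space "torus_space d" by (rule prob_space_torus)
  have "(2::real) ^ 1 \<le> 2 ^ d" using d by (intro power_increasing) auto
  then have "2 * (2 * r) ^ d \<le> 2 ^ d * (2 * r) ^ d"
    using r by (intro mult_right_mono) auto
  also have "\<dots> = (2 * (2 * r)) ^ d" by (simp only: power_mult_distrib)
  also have "\<dots> \<le> measure (torus_space d) (torus_ball p d x (real d * (2 * r)))"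
    using r by (intro measure_torus_ball_ge p d x) auto
  finally have "(2 * r) ^ d \<le> measure (torus_space d) (torus_ball p d x (real d * (2 * r))) - (2 * r) ^ d"
    by linarith
  also have "\<dots> \<le> measure (torus_space d) (torus_ball p d x (2 * real d * r))
      - measure (torus_space d) (torus_ball p d x r)"
    using measure_torus_ball_le[OF p r(1), of d x] by (simp add: mult_ac)
  also have "\<dots> = measure (torus_space d) (torus_ball p d x (2 * real d * r) - torus_ball p d x r)"
  proof (rule finite_measure_Diff[symmetric])
    have "1 * r \<le> 2 * real d * r" using d r by (intro mult_right_mono) auto
    then show "torus_ball p d x r \<subseteq> torus_ball p d x (2 * real d * r)"
      by (intro torus_ball_mono) simp
  qed measurable
  finally show ?thesis .
qed

section \<open>Connection weights of distant variables\<close>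

lemma dyadic_scale_exists:
  fixes r t :: real
  assumes "0 < r" "r < t"
  obtains i :: nat where "2 ^ i * r < t" "t \<le> 2 ^ Suc i * r"
proof -
  obtain N where "t / r < 2 ^ N"
    using real_arch_pow[of 2 "t / r"] by auto
  then have "t \<le> 2 ^ N * r" using assms by (simp add: field_simps)
  moreover have "\<not> t \<le> 2 ^ 0 * r" using assms by simp
  ultimately obtain i where "\<not> t \<le> 2 ^ i * r" "t \<le> 2 ^ Suc i * r"
    using dec_induct[of 0 N "\<lambda>i. \<not> t \<le> 2 ^ i * r"] by auto
  then show thesis using that by force
qed

lemma ennreal_le_suminf: "f i \<le> (\<Sum>i. f i)" for f :: "nat \<Rightarrow> ennreal"
  using sum_le_suminf[of f "{i}"] by (simp add: summableI)

lemma powr_tail_le_dyadic_suminf: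
  assumes r: "0 < r" and \<alpha>: "0 \<le> \<alpha>"
  shows "ennreal (t powr - \<alpha>) * indicator {r<..} t
           \<le> (\<Sum>i. ennreal ((2 ^ i * r) powr - \<alpha>) * indicator {..2 ^ Suc i * r} t)"
proof (cases "r < t")
  case True
  let ?F = "\<lambda>i. ennreal ((2 ^ i * r) powr - \<alpha>) * indicator {..2 ^ Suc i * r} t"
  obtain i where i: "2 ^ i * r < t" "t \<le> 2 ^ Suc i * r"
    by (rule dyadic_scale_exists[OF r True])
  have "t powr - \<alpha> \<le> (2 ^ i * r) powr - \<alpha>"
    using i(1) r \<alpha> by (intro powr_mono2') auto
  then have "ennreal (t powr - \<alpha>) * indicator {r<..} t \<le> ?F i"
    using True i(2) by (simp add: ennreal_leI)
  also have "\<dots> \<le> (\<Sum>i. ?F i)" by (rule ennreal_le_suminf)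
  finally show ?thesis .
qed simp

lemma powr_mult_power_dyadic:
  fixes r :: real
  assumes "0 < r"
  shows "(2 ^ i * r) powr - \<alpha> * (2 ^ Suc i * r) ^ d
           = 2 ^ d * r powr (real d - \<alpha>) * (2 powr (real d - \<alpha>)) ^ i"
proof -
  have "(2 ^ i * r) powr - \<alpha> * (2 * (2 ^ i * r)) ^ d = 2 ^ d * (2 ^ i * r) powr (real d - \<alpha>)"
    using assms by (simp add: powr_diff powr_minus_divide powr_realpow power_mult_distrib)
  also have "(2 ^ i * r) powr (real d - \<alpha>) = r powr (real d - \<alpha>) * (2 powr (real d - \<alpha>)) ^ i"
    using assms by (simp add: powr_mult powr_powr mult.commute flip: powr_realpow)
  finally show ?thesis by (simp add: mult.assoc)
qed

lemma nn_integral_powr_tail_le: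
  fixes f :: "'a \<Rightarrow> real" and d :: nat
  assumes [measurable]: "f \<in> borel_measurable M" and r: "0 < r" and A: "0 \<le> A" and \<alpha>: "real d < \<alpha>"
    and growth: "\<And>t. r \<le> t \<Longrightarrow> emeasure M {x \<in> space M. f x \<le> t} \<le> ennreal (A * t ^ d)"
  shows "(\<integral>\<^sup>+x. ennreal (f x powr - \<alpha>) * indicator {r<..} (f x) \<partial>M)
           \<le> ennreal (2 ^ d / (1 - 2 powr (real d - \<alpha>)) * A * r powr (real d - \<alpha>))"
proof -
  define \<beta> where "\<beta> = 2 powr (real d - \<alpha>)"
  have "2 powr (real d - \<alpha>) < 2 powr 0" using \<alpha> by (intro powr_less_mono) auto
  then have \<beta>: "0 < \<beta>" "\<beta> < 1" by (auto simp: \<beta>_def)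
  let ?N = "\<lambda>i::nat. {x \<in> space M. f x \<le> 2 ^ Suc i * r}"
  have scale: "ennreal ((2 ^ i * r) powr - \<alpha>) * emeasure M (?N i)
      \<le> ennreal (2 ^ d * A * r powr (real d - \<alpha>) * \<beta> ^ i)" for i
  proof -
    have "1 * r \<le> 2 ^ Suc i * r" using r by (intro mult_right_mono one_le_power) auto
    then have "ennreal ((2 ^ i * r) powr - \<alpha>) * emeasure M (?N i)
        \<le> ennreal ((2 ^ i * r) powr - \<alpha>) * ennreal (A * (2 ^ Suc i * r) ^ d)"
      by (intro mult_left_mono growth) auto
    also have "\<dots> = ennreal (A * ((2 ^ i * r) powr - \<alpha> * (2 ^ Suc i * r) ^ d))"
      using A r by (simp add: ennreal_mult mult_ac)
    finally show ?thesis
      unfolding powr_mult_power_dyadic[OF r] by (simp add: \<beta>_def mult_ac)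
  qed
  have dyadic_term: "(\<integral>\<^sup>+x. ennreal ((2 ^ i * r) powr - \<alpha>) * indicator {..2 ^ Suc i * r} (f x) \<partial>M)
      = ennreal ((2 ^ i * r) powr - \<alpha>) * emeasure M (?N i)" for i
    by (subst nn_integral_cmult_indicator[symmetric]) (auto intro!: nn_integral_cong simp: indicator_def)
  have "(\<integral>\<^sup>+x. ennreal (f x powr - \<alpha>) * indicator {r<..} (f x) \<partial>M)
      \<le> (\<integral>\<^sup>+x. (\<Sum>i. ennreal ((2 ^ i * r) powr - \<alpha>) * indicator {..2 ^ Suc i * r} (f x)) \<partial>M)"
    using r \<alpha> by (intro nn_integral_mono powr_tail_le_dyadic_suminf) auto
  also have "\<dots> = (\<Sum>i. ennreal ((2 ^ i * r) powr - \<alpha>) * emeasure M (?N i))"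
    by (subst nn_integral_suminf) (auto simp: dyadic_term simp del: power_Suc)
  also have "\<dots> \<le> (\<Sum>i. ennreal (2 ^ d * A * r powr (real d - \<alpha>) * \<beta> ^ i))"
    by (intro suminf_le scale summableI)
  also have "\<dots> = ennreal (\<Sum>i. 2 ^ d * A * r powr (real d - \<alpha>) * \<beta> ^ i)"
    using \<beta> A by (intro suminf_ennreal2 summable_mult summable_geometric) auto
  also have "(\<Sum>i. 2 ^ d * A * r powr (real d - \<alpha>) * \<beta> ^ i) = 2 ^ d * A * r powr (real d - \<alpha>) * (1 / (1 - \<beta>))"
    using \<beta> by (simp add: suminf_mult suminf_geometric summable_geometric)
  finally show ?thesis by (simp add: \<beta>_def mult_ac)
qed

lemma conn_weight_nonneg: "0 \<le> conn_weight T d p w x y"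
  by (simp add: conn_weight_def)

lemma conn_weight_measurable [measurable (raw)]:
  assumes [measurable]: "f \<in> measurable M (torus_space d)" "g \<in> measurable M (torus_space d)"
  shows "(\<lambda>z. conn_weight T d p w (f z) (g z)) \<in> borel_measurable M"
  unfolding conn_weight_def by measurable

definition rescaled_dist :: "enat \<Rightarrow> nat \<Rightarrow> real \<Rightarrow> (nat \<Rightarrow> real) \<Rightarrow> (nat \<Rightarrow> real) \<Rightarrow> real" where
  "rescaled_dist p d w x y = torus_dist p d x y / w powr (1 / real d)"

lemma rescaled_dist_measurable [measurable (raw)]:
  assumes [measurable]: "f \<in> measurable M (torus_space d)" "g \<in> measurable M (torus_space d)"
  shows "(\<lambda>z. rescaled_dist p d w (f z) (g z)) \<in> borel_measurable M"
  unfolding rescaled_dist_def by measurable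

lemma conn_weight_eq_powr:
  assumes "x \<in> unit_cube d" "y \<in> unit_cube d" "p \<ge> 1" "d \<ge> 1" "w > 0"
  shows "conn_weight T d p w x y = rescaled_dist p d w x y powr (- real d / T)"
proof (cases "torus_dist p d x y = 0")
  case True
  then show ?thesis using assms(4) by (simp add: conn_weight_def rescaled_dist_def)
next
  case False
  then have dist: "torus_dist p d x y > 0"
    using torus_dist_nonneg[OF assms(1-4)] by simp
  have "w / torus_dist p d x y ^ d = rescaled_dist p d w x y powr (- real d)"
    unfolding rescaled_dist_def
    using dist assms(4,5) by (simp add: powr_minus_divide powr_realpow power_divide powr_inverse_power)
  then show ?thesis by (simp add: conn_weight_def powr_powr)
qed

lemma mem_torus_ball_iff_rescaled_dist_le:
  assumes "x \<in> unit_cube d" "y \<in> unit_cube d" "w > 0"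
  shows "y \<in> torus_ball p d x (r * w powr (1 / real d)) \<longleftrightarrow> rescaled_dist p d w x y \<le> r"
  using assms by (simp add: torus_ball_def rescaled_dist_def pos_divide_le_eq)

lemma measure_rescaled_torus_ball_le:
  assumes "p \<ge> 1" "d \<ge> 1" "0 \<le> r" "0 \<le> w"
  shows "measure (torus_space d) (torus_ball p d x (r * w powr (1 / real d))) \<le> (2 * r) ^ d * w"
  using measure_torus_ball_le[of p "r * w powr (1 / real d)" d x] assms
  by (simp add: power_mult_distrib powr_inverse_power)

lemma nn_integral_conn_weight_tail_le:
  assumes p: "p \<ge> 1" and d: "d \<ge> 1" and r: "r > 0" and w: "w > 0" and T: "0 < T" "T < 1"
    and y: "y \<in> unit_cube d"
  shows "(\<integral>\<^sup>+x. ennreal (conn_weight T d p w x y) * indicator {r<..} (rescaled_dist p d w x y) \<partial>torus_space d)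
       \<le> ennreal (4 ^ d / (1 - 2 powr (real d - real d / T)) * (r ^ d * w) * r powr (- real d / T))"
proof -
  interpret prob_space "torus_space d" by (rule prob_space_torus)
  let ?\<delta> = "\<lambda>x. rescaled_dist p d w x y"
  have [measurable]: "y \<in> space (torus_space d)" using y by (rule unit_cube_in_space)
  have ball: "emeasure (torus_space d) {x \<in> space (torus_space d). ?\<delta> x \<le> t} \<le> ennreal (2 ^ d * w * t ^ d)"
    if t: "r \<le> t" for t
  proof -
    have "AE x in torus_space d. x \<in> {x \<in> space (torus_space d). ?\<delta> x \<le> t} \<longrightarrow>
        x \<in> torus_ball p d y (t * w powr (1 / real d))"
      using AE_unit_cube
      by eventually_elim (simp add: torus_ball_commute[of _ p d y] mem_torus_ball_iff_rescaled_dist_le y w)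
    then have "emeasure (torus_space d) {x \<in> space (torus_space d). ?\<delta> x \<le> t}
        \<le> emeasure (torus_space d) (torus_ball p d y (t * w powr (1 / real d)))"
      by (rule emeasure_mono_AE) measurable
    also have "\<dots> \<le> ennreal ((2 * t) ^ d * w)"
      unfolding emeasure_eq_measure
      using r t w by (intro ennreal_leI measure_rescaled_torus_ball_le p d) auto
    finally show ?thesis by (simp add: power_mult_distrib mult_ac)
  qed
  have "(\<integral>\<^sup>+x. ennreal (conn_weight T d p w x y) * indicator {r<..} (?\<delta> x) \<partial>torus_space d)
      = (\<integral>\<^sup>+x. ennreal (?\<delta> x powr - (real d / T)) * indicator {r<..} (?\<delta> x) \<partial>torus_space d)"
    by (rule nn_integral_cong_AE)
       (use AE_unit_cube in \<open>eventually_elim, simp add: conn_weight_eq_powr[OF _ y p d w]\<close>)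
  also have "\<dots> \<le> ennreal (2 ^ d / (1 - 2 powr (real d - real d / T)) * (2 ^ d * w) *
      r powr (real d - real d / T))"
    by (rule nn_integral_powr_tail_le[OF _ r _ _ ball]) (use d T w in \<open>simp_all add: field_simps\<close>)
  also have "r powr (real d - real d / T) = r ^ d * r powr (- real d / T)"
    using powr_add[of r "real d" "- real d / T"] r by (simp add: powr_realpow)
  also have "2 ^ d / (1 - 2 powr (real d - real d / T)) * (2 ^ d * w) * (r ^ d * r powr (- real d / T))
      = 4 ^ d / (1 - 2 powr (real d - real d / T)) * (r ^ d * w) * r powr (- real d / T)"
    using power_mult_distrib[of "2::real" 2 d] by simp
  finally show ?thesis .
qed

section \<open>Layered clause positions\<close>

locale geometric_model =
  fixes d k :: nat and p :: enat and T B :: real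
  assumes d_pos: "d \<ge> 1" and p_pos: "p \<ge> 1" and T_pos: "0 < T" and T_less_1: "T < 1" and B_pos: "0 < B"
begin

text \<open>
  The radii are scaled so that \<open>(2 * shell_radius n k) ^ d = 1 / (2 * B * n)\<close>: since the weights sum to
  at most \<open>B * n\<close>, at most half a variable is expected within the largest radius. Correspondingly,
  \<open>layer_const\<close> is \<open>(n / 2) ^ k\<close>, a lower bound for the number of ways to choose the variables in the
  shells, times \<open>(shell_radius n 0 ^ d) ^ k / 2\<close>, one for the probability of each choice. The rate
  \<open>decay_rate\<close> is the smallest of the exponents in the three concentration bounds: for the layered
  volume, for the number of promising clauses and for the number of nice ones among them.
\<close>

definition shell_radius :: "nat \<Rightarrow> nat \<Rightarrow> real" where
  "shell_radius n j = (2 * real d) ^ j * ((1 / (2 * B * real n)) powr (1 / real d) / (2 * (2 * real d) ^ k))"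

definition layer_const :: real where
  "layer_const = (1 / (4 * B * (2 * (2 * real d) ^ k) ^ d)) ^ k / 2"

definition tail_const :: real where
  "tail_const = 4 ^ d / (1 - 2 powr (real d - real d / T))"

definition tail_bound :: real where
  "tail_bound = 4 * tail_const / layer_const"

definition nice_const :: real where
  "nice_const = (1 / (real k + tail_bound)) ^ k"

lemma layer_const_pos: "0 < layer_const"
  using d_pos B_pos by (simp add: layer_const_def)

lemma tail_const_pos: "0 < tail_const"
proof -
  have "real d - real d / T < 0" using d_pos T_pos T_less_1 by (simp add: field_simps)
  then have "2 powr (real d - real d / T) < 2 powr 0" by (intro powr_less_mono) auto
  then show ?thesis by (simp add: tail_const_def)
qed

lemma tail_bound_pos: "0 < tail_bound"
  by (simp add: tail_bound_def tail_const_pos layer_const_pos)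

lemma nice_const_pos: "0 < nice_const"
  using tail_bound_pos by (simp add: nice_const_def)

definition nice_density :: real where
  "nice_density = layer_const * nice_const / 16"

definition decay_rate :: real where
  "decay_rate = min (layer_const\<^sup>2 * B / 2) (min (layer_const\<^sup>2 / 32) (layer_const * nice_const\<^sup>2 / 16))"

lemma nice_density_pos: "0 < nice_density"
  by (simp add: nice_density_def layer_const_pos nice_const_pos)

lemma decay_rate_pos: "0 < decay_rate"
  using layer_const_pos nice_const_pos B_pos by (simp add: decay_rate_def)

end

abbreviation tuple_space :: "nat \<Rightarrow> nat \<Rightarrow> (nat \<Rightarrow> nat \<Rightarrow> real) measure" where
  "tuple_space d n \<equiv> PiM {..<n} (\<lambda>_. torus_space d)"

lemma tuple_component_measurable:
  assumes "v < n" "f \<in> measurable N (tuple_space d n)"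
  shows "(\<lambda>z. f z v) \<in> measurable N (torus_space d)"
  by (rule measurable_compose[OF assms(2) measurable_component_singleton]) (use assms(1) in simp)

lemma finite_product_prob_space_torus: "finite_product_prob_space (\<lambda>_. torus_space d) {..<n::nat}"
  by (intro finite_product_prob_spaceI prob_space_torus) simp

lemma AE_tuple_unit_cube: "AE xs in tuple_space d n. \<forall>v<n. xs v \<in> unit_cube d"
proof -
  have "AE xs in tuple_space d n. \<forall>v\<in>{..<n}. xs v \<in> unit_cube d"
    by (intro AE_finite_allI AE_PiM_component) (auto intro: prob_space_torus AE_unit_cube)
  then show ?thesis by eventually_elim simp
qed

locale geometric_instance = geometric_model +
  fixes n :: nat and w :: "nat \<Rightarrow> real"
  assumes n_pos: "0 < n" and n_ge: "2 * k \<le> n"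
    and w_ge_1: "v < n \<Longrightarrow> 1 \<le> w v" and sum_w_le: "(\<Sum>v<n. w v) \<le> B * real n"
begin

sublocale torus: prob_space "torus_space d"
  by (rule prob_space_torus)

sublocale variables: finite_product_prob_space "\<lambda>_. torus_space d" "{..<n}"
  by (rule finite_product_prob_space_torus)

abbreviation "radius \<equiv> shell_radius n"

lemma w_pos: "v < n \<Longrightarrow> 0 < w v"
  using w_ge_1[of v] by simp

lemma radius_pos: "0 < radius j"
  using d_pos B_pos n_pos by (simp add: shell_radius_def)

lemma radius_Suc: "radius (Suc j) = 2 * real d * radius j"
  by (simp add: shell_radius_def)

lemma radius_mono: "i \<le> j \<Longrightarrow> radius i \<le> radius j"
  unfolding shell_radius_def using d_pos B_pos by (intro mult_right_mono power_increasing) auto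

lemma outer_cube_volume: "(2 * radius k) ^ d = 1 / (2 * B * real n)"
  using d_pos B_pos by (simp add: shell_radius_def powr_inverse_power)

lemma inner_radius_power: "radius 0 ^ d = 1 / (2 * B * real n * (2 * (2 * real d) ^ k) ^ d)"
  using d_pos B_pos by (simp add: shell_radius_def power_divide powr_inverse_power)

definition var_ball :: "nat \<Rightarrow> real \<Rightarrow> (nat \<Rightarrow> real) \<Rightarrow> (nat \<Rightarrow> real) set" where
  "var_ball v r x = torus_ball p d x (r * w v powr (1 / real d))"

definition var_shell :: "(nat \<Rightarrow> real) \<Rightarrow> nat \<Rightarrow> nat \<Rightarrow> (nat \<Rightarrow> real) set" where
  "var_shell x v j = var_ball v (radius (Suc j)) x - var_ball v (radius j) x"

definition layered_by :: "(nat \<Rightarrow> nat \<Rightarrow> real) \<Rightarrow> (nat \<Rightarrow> real) \<Rightarrow> nat list \<Rightarrow> bool" where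
  "layered_by xs x vs \<longleftrightarrow>
     vs \<in> arrangements k {..<n} \<and> occupies_cells (var_shell x) (\<lambda>v. var_ball v (radius k) x) {..<n} xs vs"

definition layered :: "(nat \<Rightarrow> nat \<Rightarrow> real) \<Rightarrow> (nat \<Rightarrow> real) \<Rightarrow> bool" where
  "layered xs x \<longleftrightarrow> (\<exists>vs. layered_by xs x vs)"

definition layered_vol :: "(nat \<Rightarrow> nat \<Rightarrow> real) \<Rightarrow> real" where
  "layered_vol xs = torus.prob {x \<in> space (torus_space d). layered xs x}"

lemma var_ball_mono: "r \<le> s \<Longrightarrow> var_ball v r x \<subseteq> var_ball v s x"
  unfolding var_ball_def by (intro torus_ball_mono mult_right_mono) auto

lemma var_ball_commute: "y \<in> var_ball v r x \<longleftrightarrow> x \<in> var_ball v r y"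
  unfolding var_ball_def by (rule torus_ball_commute)

lemma var_ball_sets [measurable]: "var_ball v r x \<in> sets (torus_space d)"
  unfolding var_ball_def by measurable

lemma var_ball_measurable [measurable (raw)]:
  assumes [measurable]: "f \<in> measurable M (torus_space d)" "g \<in> measurable M (torus_space d)"
  shows "Measurable.pred M (\<lambda>z. g z \<in> var_ball v r (f z))"
  unfolding var_ball_def by measurable

lemma layered_by_measurable:
  assumes f: "f \<in> measurable N (tuple_space d n)" and g: "g \<in> measurable N (torus_space d)"
  shows "Measurable.pred N (\<lambda>z. layered_by (f z) (g z) vs)"
proof (cases "vs \<in> arrangements k {..<n}")
  case True
  then have "vs ! j < n" if "j < length vs" for j
    using nth_mem[OF that] by (auto simp: arrangements_def)
  note ball = var_ball_measurable[OF g tuple_component_measurable[OF _ f]]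
  have "Measurable.pred N (\<lambda>z. f z (vs ! j) \<in> var_shell (g z) (vs ! j) j)" if "j < length vs" for j
    unfolding var_shell_def Diff_iff using \<open>\<And>j. j < length vs \<Longrightarrow> vs ! j < n\<close>[OF that]
    by (intro pred_intros_logic ball)
  then show ?thesis
    using True unfolding layered_by_def occupies_cells_def
    by (intro pred_intros_logic pred_intros_countable pred_intros_imp' pred_intros_finite ball) auto
qed (simp add: layered_by_def)

lemma layered_measurable [measurable (raw)]:
  assumes "f \<in> measurable N (tuple_space d n)" "g \<in> measurable N (torus_space d)"
  shows "Measurable.pred N (\<lambda>z. layered (f z) (g z))"
  unfolding layered_def by (intro pred_intros_countable layered_by_measurable assms)

lemma layered_vol_measurable [measurable]: "layered_vol \<in> borel_measurable (tuple_space d n)"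
  unfolding layered_vol_def by measurable

lemma prob_var_ball_le:
  assumes "v < n"
  shows "torus.prob (var_ball v (radius k) x) \<le> w v / (2 * B * real n)"
proof -
  have "torus.prob (var_ball v (radius k) x) \<le> (2 * radius k) ^ d * w v"
    unfolding var_ball_def
    by (intro measure_rescaled_torus_ball_le p_pos d_pos less_imp_le[OF radius_pos] less_imp_le[OF w_pos] assms)
  then show ?thesis unfolding outer_cube_volume by simp
qed

lemma sum_weight_fraction_le: "(\<Sum>v<n. w v / (2 * B * real n)) \<le> 1 / 2"
  using sum_w_le B_pos n_pos by (simp add: divide_le_eq mult_ac flip: sum_divide_distrib)

lemma weight_fraction_le:
  assumes "v < n"
  shows "w v / (2 * B * real n) \<le> 1 / 2"
proof -
  have "w v / (2 * B * real n) \<le> (\<Sum>v<n. w v / (2 * B * real n))"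
    using assms B_pos w_pos by (intro member_le_sum) (auto intro: less_imp_le)
  then show ?thesis using sum_weight_fraction_le by simp
qed

lemma prob_var_shell_ge:
  assumes v: "v < n" and j: "j < k" and x: "x \<in> unit_cube d"
  shows "radius 0 ^ d \<le> torus.prob (var_shell x v j)"
proof -
  let ?s = "radius j * w v powr (1 / real d)"
  have s: "0 \<le> ?s" using radius_pos[of j] by simp
  have "(2 * (2 * real d * ?s)) ^ d = (2 * radius (Suc j)) ^ d * w v"
    using w_pos[OF v] d_pos by (simp add: radius_Suc power_mult_distrib powr_inverse_power)
  also have "\<dots> \<le> (2 * radius k) ^ d * w v"
    using radius_mono[of "Suc j" k] radius_pos[of "Suc j"] w_pos[OF v] j
    by (intro mult_right_mono power_mono) auto
  also have "\<dots> \<le> 1"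
    using weight_fraction_le[OF v] unfolding outer_cube_volume by simp
  finally have "2 * (2 * real d * ?s) \<le> 1"
    using d_pos s by (subst (asm) power_le_one_iff) auto
  moreover have "1 * ?s \<le> real d * ?s"
    using d_pos s by (intro mult_right_mono) auto
  ultimately have "4 * ?s \<le> 1" by simp
  have "radius 0 ^ d * 1 \<le> (2 * radius j) ^ d * w v"
    using radius_mono[of 0 j] radius_pos[of 0] w_ge_1[OF v] by (intro mult_mono power_mono) auto
  also have "\<dots> = (2 * ?s) ^ d"
    using w_pos[OF v] d_pos by (simp add: power_mult_distrib powr_inverse_power)
  also have "\<dots> \<le> torus.prob (var_shell x v j)"
    using measure_torus_shell_ge[OF p_pos d_pos x s \<open>4 * ?s \<le> 1\<close>]
    by (simp add: var_shell_def var_ball_def radius_Suc mult_ac)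
  finally show ?thesis by simp
qed

lemma cell_partition_var_shell:
  "cell_partition (\<lambda>_. torus_space d) {..<n} k (var_shell x) (\<lambda>v. var_ball v (radius k) x)"
proof
  fix v j assume "v \<in> {..<n}" "j < k"
  then have "var_ball v (radius (Suc j)) x \<subseteq> var_ball v (radius k) x"
    by (intro var_ball_mono radius_mono) simp
  then show "var_shell x v j \<subseteq> var_ball v (radius k) x"
    by (auto simp: var_shell_def)
next
  fix v j l :: nat assume "j \<noteq> l"
  moreover have "var_shell x v i \<inter> var_shell x v i' = {}" if "i < i'" for i i'
    using var_ball_mono[OF radius_mono[of "Suc i" i'], of v x] that by (auto simp: var_shell_def)
  ultimately show "var_shell x v j \<inter> var_shell x v l = {}"
    by (metis inf_commute nat_neq_iff)
qed (auto simp: var_shell_def)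

lemma prob_layered_ge:
  assumes x: "x \<in> unit_cube d"
  shows "layer_const \<le> variables.prob {xs \<in> space (tuple_space d n). layered xs x}"
proof -
  interpret cell_partition "\<lambda>_. torus_space d" "{..<n}" k "var_shell x" "\<lambda>v. var_ball v (radius k) x"
    by (rule cell_partition_var_shell)
  have "(\<Sum>v<n. torus.prob (var_ball v (radius k) x)) \<le> (\<Sum>v<n. w v / (2 * B * real n))"
    by (intro sum_mono prob_var_ball_le) simp
  then have far: "1 / 2 \<le> 1 - (\<Sum>v<n. torus.prob (var_ball v (radius k) x))"
    using sum_weight_fraction_le by simp
  have "(real n / 2) ^ k \<le> real (card {..<n} - k + 1) ^ k"
    using n_ge by (intro power_mono) auto
  also have "\<dots> \<le> real (card (arrangements k {..<n}))"
    using n_ge by (intro card_arrangements_ge) auto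
  finally have arrangements: "(real n / 2) ^ k \<le> real (card (arrangements k {..<n}))" .
  have "layer_const = (real n / 2 * radius 0 ^ d) ^ k / 2"
    unfolding layer_const_def inner_radius_power using n_pos by (simp add: mult.assoc)
  also have "\<dots> = (real n / 2) ^ k * ((radius 0 ^ d) ^ k * (1 / 2))"
    unfolding power_mult_distrib by simp
  also have "\<dots> \<le> real (card (arrangements k {..<n})) *
      ((radius 0 ^ d) ^ k * (1 - (\<Sum>v<n. torus.prob (var_ball v (radius k) x))))"
    using radius_pos[of 0] by (intro mult_mono arrangements far order_refl) auto
  also have "\<dots> \<le> variables.prob {xs \<in> space (tuple_space d n).
      \<exists>vs\<in>arrangements k {..<n}. occupies_cells (var_shell x) (\<lambda>v. var_ball v (radius k) x) {..<n} xs vs}"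
    using radius_pos[of 0] x by (intro prob_ex_occupies_cells_ge prob_var_shell_ge) auto
  finally show ?thesis
    by (simp add: layered_def layered_by_def Bex_def)
qed

lemma layer_const_le_expectation: "layer_const \<le> variables.expectation layered_vol"
proof -
  interpret pair_prob_space "tuple_space d n" "torus_space d" ..
  let ?prob_layered = "\<lambda>x. variables.prob {xs \<in> space (tuple_space d n). layered xs x}"
  have "integrable (torus_space d) ?prob_layered"
    by (rule torus.integrable_const_bound[where B = 1]) (auto, measurable)
  then have "layer_const \<le> torus.expectation ?prob_layered"
    by (rule torus.integral_ge_const) (rule eventually_mono[OF AE_unit_cube prob_layered_ge])
  also have "\<dots> = variables.expectation layered_vol"
    unfolding layered_vol_def by (rule integral_prob_section_swap[symmetric]) measurable
  finally show ?thesis .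
qed

lemma layered_update:
  assumes "layered xs x" and old: "x \<notin> var_ball v (radius k) (xs v)" and new: "x \<notin> var_ball v (radius k) y"
  shows "layered (xs(v := y)) x"
proof -
  obtain vs where layers: "layered_by xs x vs" using assms(1) by (auto simp: layered_def)
  have "vs ! j \<noteq> v" if "j < length vs" for j
  proof -
    have "j < k" using layers that by (simp add: layered_by_def arrangements_def)
    then have "xs (vs ! j) \<in> var_ball (vs ! j) (radius k) x"
      using layers that var_ball_mono[OF radius_mono[of "Suc j" k]]
      by (auto simp: layered_by_def occupies_cells_def var_shell_def)
    then show ?thesis using old var_ball_commute[of x] by auto
  qed
  then have "layered_by (xs(v := y)) x vs"
    using layers new var_ball_commute[of x] by (auto simp: layered_by_def occupies_cells_def)
  then show ?thesis by (auto simp: layered_def)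
qed

lemma layered_vol_update_le:
  assumes xs: "xs \<in> space (tuple_space d n)" and v: "v < n" and y: "y \<in> space (torus_space d)"
  shows "layered_vol xs \<le> layered_vol (xs(v := y)) + w v / (B * real n)"
proof -
  have [measurable]: "xs(v := y) \<in> space (tuple_space d n)"
    using fun_upd_in_space_PiM[OF xs _ y] v by simp
  have layered_sets: "{x \<in> space (torus_space d). layered (xs(v := y)) x} \<in> torus.events"
    by measurable
  let ?near = "\<lambda>y. var_ball v (radius k) y"
  have "layered_vol xs
      \<le> torus.prob ({x \<in> space (torus_space d). layered (xs(v := y)) x} \<union> ?near (xs v) \<union> ?near y)"
    unfolding layered_vol_def
    by (rule torus.finite_measure_mono)
       (use layered_update layered_sets in auto)
  also have "\<dots> \<le> layered_vol (xs(v := y)) + torus.prob (?near (xs v)) + torus.prob (?near y)"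
    unfolding layered_vol_def
    by (intro order_trans[OF measure_Un_le] add_mono order_refl) (use layered_sets in auto)
  also have "\<dots> \<le> layered_vol (xs(v := y)) + w v / (2 * B * real n) + w v / (2 * B * real n)"
    by (intro add_mono prob_var_ball_le v order_refl)
  finally show ?thesis by simp
qed

lemma bounded_differences_layered_vol:
  "bounded_differences {..<n} (\<lambda>_. torus_space d) (\<lambda>v. w v / (B * real n)) layered_vol"
  unfolding bounded_differences_def
proof (intro ballI)
  fix xs v y assume xs: "xs \<in> space (tuple_space d n)" and v: "v \<in> {..<n}" and y: "y \<in> space (torus_space d)"
  have xs': "xs(v := y) \<in> space (tuple_space d n)"
    by (rule fun_upd_in_space_PiM[OF xs v y])
  have "xs v \<in> space (torus_space d)"
    using xs v by (auto simp: space_PiM PiE_iff)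
  then show "\<bar>layered_vol (xs(v := y)) - layered_vol xs\<bar> \<le> w v / (B * real n)"
    using layered_vol_update_le[OF xs _ y, of v] layered_vol_update_le[OF xs', of v "xs v"] v
    by (simp add: abs_le_iff)
qed

lemma prob_layered_vol_small_le:
  assumes \<tau>: "0 < \<tau>" "\<And>v. v < n \<Longrightarrow> \<tau> * w v \<le> real n"
  shows "variables.prob {xs \<in> space (tuple_space d n). layered_vol xs \<le> layer_const / 2}
           \<le> exp (- (layer_const\<^sup>2 * B / 2) * \<tau>)"
proof -
  have "(\<Sum>v<n. (w v / (B * real n))\<^sup>2) \<le> (\<Sum>v<n. 2 / (B * \<tau>) * (w v / (2 * B * real n)))"
  proof (rule sum_mono)
    fix v assume v: "v \<in> {..<n}"
    have "w v / (B * real n) \<le> 1 / (B * \<tau>)"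
      using \<tau>(1) \<tau>(2)[of v] v B_pos n_pos by (simp add: field_simps)
    then have "w v / (B * real n) * (w v / (B * real n)) \<le> 1 / (B * \<tau>) * (w v / (B * real n))"
      using w_pos[of v] v B_pos by (intro mult_right_mono) auto
    then show "(w v / (B * real n))\<^sup>2 \<le> 2 / (B * \<tau>) * (w v / (2 * B * real n))"
      by (simp add: power2_eq_square)
  qed
  also have "\<dots> \<le> 2 / (B * \<tau>) * (1 / 2)"
    unfolding sum_distrib_left[symmetric]
    using \<tau>(1) B_pos by (intro mult_left_mono sum_weight_fraction_le) auto
  finally have influences: "(\<Sum>v<n. (w v / (B * real n))\<^sup>2) \<le> 1 / (B * \<tau>)" by simp
  have "variables.prob {xs \<in> space (tuple_space d n). layered_vol xs \<le> layer_const / 2}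
      \<le> variables.prob {xs \<in> space (tuple_space d n).
          layered_vol xs \<le> variables.expectation layered_vol - layer_const / 2}"
    by (rule variables.finite_measure_mono) (use layer_const_le_expectation in auto)
  also have "\<dots> \<le> exp (- 2 * (layer_const / 2)\<^sup>2 / (1 / (B * \<tau>)))"
    using \<tau>(1) B_pos layer_const_pos
    by (intro variables.McDiarmid_ineq_le[OF _ bounded_differences_layered_vol _ influences]) auto
  also have "\<dots> = exp (- (layer_const\<^sup>2 * B / 2) * \<tau>)"
    using \<tau>(1) B_pos by (simp add: power_divide)
  finally show ?thesis .
qed

section \<open>Nice clauses\<close>

definition tail_sum :: "(nat \<Rightarrow> nat \<Rightarrow> real) \<Rightarrow> (nat \<Rightarrow> real) \<Rightarrow> real" where
  "tail_sum xs x =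
     (\<Sum>v<n. conn_weight T d p (w v) x (xs v) * indicator {radius k<..} (rescaled_dist p d (w v) x (xs v)))"

lemma tail_sum_measurable [measurable (raw)]:
  assumes f: "f \<in> measurable N (tuple_space d n)" and g: "g \<in> measurable N (torus_space d)"
  shows "(\<lambda>z. tail_sum (f z) (g z)) \<in> borel_measurable N"
  unfolding tail_sum_def
proof (rule borel_measurable_sum)
  fix v assume "v \<in> {..<n}"
  then have [measurable]: "(\<lambda>z. f z v) \<in> measurable N (torus_space d)"
    by (intro tuple_component_measurable[OF _ f]) simp
  note [measurable] = g
  show "(\<lambda>z. conn_weight T d p (w v) (g z) (f z v) *
      indicator {radius k<..} (rescaled_dist p d (w v) (g z) (f z v))) \<in> borel_measurable N"
    by measurable
qed

lemma nn_integral_tail_sum_le: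
  assumes xs: "\<And>v. v < n \<Longrightarrow> xs v \<in> unit_cube d"
  shows "(\<integral>\<^sup>+x. ennreal (tail_sum xs x) \<partial>torus_space d) \<le> ennreal (tail_const * radius k powr (- real d / T))"
proof -
  let ?R = "radius k powr (- real d / T)"
  let ?tail = "\<lambda>v x. ennreal (conn_weight T d p (w v) x (xs v)) *
    indicator {radius k<..} (rescaled_dist p d (w v) x (xs v))"
  have tail_measurable: "?tail v \<in> borel_measurable (torus_space d)" if "v < n" for v
  proof -
    have [measurable]: "xs v \<in> space (torus_space d)" using xs[OF that] by (rule unit_cube_in_space)
    show ?thesis by measurable
  qed
  have "(\<integral>\<^sup>+x. ennreal (tail_sum xs x) \<partial>torus_space d) = (\<integral>\<^sup>+x. (\<Sum>v<n. ?tail v x) \<partial>torus_space d)"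
    unfolding tail_sum_def
    by (simp add: conn_weight_nonneg ennreal_mult ennreal_indicator flip: sum_ennreal)
  also have "\<dots> = (\<Sum>v<n. \<integral>\<^sup>+x. ?tail v x \<partial>torus_space d)"
    by (rule nn_integral_sum) (use tail_measurable in auto)
  also have "\<dots> \<le> (\<Sum>v<n. ennreal (tail_const * (radius k ^ d * w v) * ?R))"
    unfolding tail_const_def
    by (intro sum_mono nn_integral_conn_weight_tail_le p_pos d_pos radius_pos w_pos T_pos T_less_1 xs) auto
  also have "\<dots> = ennreal (\<Sum>v<n. tail_const * (radius k ^ d * w v) * ?R)"
    using tail_const_pos radius_pos[of k] w_pos
    by (intro sum_ennreal) (auto intro!: mult_nonneg_nonneg less_imp_le)
  also have "(\<Sum>v<n. tail_const * (radius k ^ d * w v) * ?R) = tail_const * ?R * (\<Sum>v<n. radius k ^ d * w v)"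
    by (simp add: sum_distrib_left mult_ac)
  also have "\<dots> \<le> tail_const * ?R * 1"
  proof (rule mult_left_mono)
    have "radius k ^ d * w v \<le> (2 * radius k) ^ d * w v" if "v < n" for v
      using radius_pos[of k] w_pos[OF that] by (intro mult_right_mono power_mono) auto
    then have "(\<Sum>v<n. radius k ^ d * w v) \<le> (\<Sum>v<n. w v / (2 * B * real n))"
      unfolding outer_cube_volume by (intro sum_mono) auto
    then show "(\<Sum>v<n. radius k ^ d * w v) \<le> 1" using sum_weight_fraction_le by simp
  qed (use tail_const_pos in simp)
  finally show ?thesis by (simp add: ennreal_leI)
qed

lemma prob_tail_sum_large_le:
  assumes xs: "xs \<in> space (tuple_space d n)" "\<And>v. v < n \<Longrightarrow> xs v \<in> unit_cube d"
  shows "torus.prob {x \<in> space (torus_space d). tail_bound * radius k powr (- real d / T) \<le> tail_sum xs x}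
           \<le> layer_const / 4"
proof -
  note [measurable] = xs(1)
  let ?R = "radius k powr (- real d / T)"
  define b where "b = tail_bound * ?R"
  have b: "0 < b" using tail_bound_pos radius_pos[of k] by (simp add: b_def)
  have "b \<le> t \<longleftrightarrow> 1 \<le> ennreal (1 / b) * ennreal t" for t
    using b by (simp add: pos_le_divide_eq ennreal_mult'[symmetric])
  then have "emeasure (torus_space d) {x \<in> space (torus_space d). b \<le> tail_sum xs x}
      \<le> ennreal (1 / b) * (\<integral>\<^sup>+x. ennreal (tail_sum xs x) * indicator (space (torus_space d)) x \<partial>torus_space d)"
    by (simp only:) (rule nn_integral_Markov_inequality, measurable)
  also have "\<dots> = ennreal (1 / b) * (\<integral>\<^sup>+x. ennreal (tail_sum xs x) \<partial>torus_space d)"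
    by (intro arg_cong2[where f = "(*)"] nn_integral_cong) auto
  also have "\<dots> \<le> ennreal (1 / b) * ennreal (tail_const * ?R)"
    by (intro mult_left_mono nn_integral_tail_sum_le xs) auto
  also have "\<dots> = ennreal (layer_const / 4)"
    using tail_const_pos layer_const_pos radius_pos[of k] b
    by (simp add: b_def tail_bound_def flip: ennreal_mult)
  finally show ?thesis
    using layer_const_pos by (simp add: b_def torus.emeasure_eq_measure)
qed

definition promising :: "(nat \<Rightarrow> nat \<Rightarrow> real) \<Rightarrow> (nat \<Rightarrow> real) \<Rightarrow> bool" where
  "promising xs x \<longleftrightarrow>
     x \<in> unit_cube d \<and> layered xs x \<and> tail_sum xs x \<le> tail_bound * radius k powr (- real d / T)"

lemma promising_measurable [measurable (raw)]:
  assumes [measurable]: "f \<in> measurable N (tuple_space d n)" "g \<in> measurable N (torus_space d)"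
  shows "Measurable.pred N (\<lambda>z. promising (f z) (g z))"
  unfolding promising_def by measurable

lemma prob_promising_ge:
  assumes xs: "xs \<in> space (tuple_space d n)" "\<And>v. v < n \<Longrightarrow> xs v \<in> unit_cube d"
    and vol: "layer_const / 2 \<le> layered_vol xs"
  shows "layer_const / 4 \<le> torus.prob {x \<in> space (torus_space d). promising xs x}"
proof -
  note [measurable] = xs(1)
  let ?promising = "{x \<in> space (torus_space d). promising xs x}"
  let ?large = "{x \<in> space (torus_space d). tail_bound * radius k powr (- real d / T) \<le> tail_sum xs x}"
  have "layered_vol xs \<le> torus.prob (?promising \<union> ?large)"
    unfolding layered_vol_def
  proof (rule torus.finite_measure_mono_AE)
    show "AE x in torus_space d. x \<in> {x \<in> space (torus_space d). layered xs x} \<longrightarrow> x \<in> ?promising \<union> ?large"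
      using AE_unit_cube by eventually_elim (auto simp: promising_def)
  qed measurable
  also have "\<dots> \<le> torus.prob ?promising + torus.prob ?large"
    by (rule measure_Un_le) measurable
  finally show ?thesis using vol prob_tail_sum_large_le[OF xs] by simp
qed

context
  fixes xs x vs
  assumes xs: "v < n \<Longrightarrow> xs v \<in> unit_cube d" and x: "x \<in> unit_cube d" and layers: "layered_by xs x vs"
begin

abbreviation "\<delta> v \<equiv> rescaled_dist p d (w v) x (xs v)"

lemma mem_var_ball_iff: "v < n \<Longrightarrow> xs v \<in> var_ball v r x \<longleftrightarrow> \<delta> v \<le> r"
  unfolding var_ball_def by (rule mem_torus_ball_iff_rescaled_dist_le[OF x xs w_pos])

lemma layers_arrangement: "length vs = k" "set vs \<subseteq> {..<n}"
  using layers by (auto simp: layered_by_def arrangements_def)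

lemma layers_nth_less: "j < k \<Longrightarrow> vs ! j < n"
  using layers_arrangement by (metis lessThan_iff nth_mem subsetD)

lemma layers_nth:
  assumes "j < k"
  shows "radius j < \<delta> (vs ! j)" "\<delta> (vs ! j) \<le> radius (Suc j)"
proof -
  have "vs ! j < n" using assms by (rule layers_nth_less)
  then show "radius j < \<delta> (vs ! j)" "\<delta> (vs ! j) \<le> radius (Suc j)"
    using layers assms layers_arrangement(1)
    by (auto simp: layered_by_def occupies_cells_def var_shell_def mem_var_ball_iff)
qed

lemma layers_inside:
  assumes "u \<in> set vs"
  shows "0 < \<delta> u" "\<delta> u \<le> radius k"
proof -
  obtain j where j: "j < k" "u = vs ! j"
    using assms layers_arrangement(1) by (auto simp: in_set_conv_nth)
  show "0 < \<delta> u" using layers_nth(1)[OF j(1)] radius_pos[of j] j(2) by simp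
  have "\<delta> u \<le> radius (Suc j)" using layers_nth(2)[OF j(1)] j(2) by simp
  also have "\<dots> \<le> radius k" using j(1) by (intro radius_mono) simp
  finally show "\<delta> u \<le> radius k" .
qed

lemma layers_outside: "v < n \<Longrightarrow> v \<notin> set vs \<Longrightarrow> radius k < \<delta> v"
  using layers mem_var_ball_iff[of v "radius k"] by (auto simp: layered_by_def occupies_cells_def)

lemma rescaled_dist_pos: "v < n \<Longrightarrow> 0 < \<delta> v"
  using layers_inside(1) layers_outside less_trans[OF radius_pos] by (cases "v \<in> set vs") auto

abbreviation "X v \<equiv> conn_weight T d p (w v) x (xs v)"

lemma conn_weight_eq: "v < n \<Longrightarrow> X v = \<delta> v powr (- real d / T)"
  by (rule conn_weight_eq_powr[OF x xs p_pos d_pos w_pos])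

lemma conn_weight_less:
  assumes "u < n" "v < n" "\<delta> u < \<delta> v"
  shows "X v < X u"
  unfolding conn_weight_eq[OF assms(1)] conn_weight_eq[OF assms(2)]
  using assms rescaled_dist_pos d_pos T_pos by (intro powr_less_mono2_neg) auto

lemma sorted_wrt_conn_weight: "sorted_wrt (\<lambda>u v. X v < X u) vs"
  unfolding sorted_wrt_iff_nth_less
proof (intro allI impI)
  fix i j assume ij: "i < j" "j < length vs"
  have "\<delta> (vs ! i) \<le> radius (Suc i)" using layers_nth(2) ij layers_arrangement(1) by simp
  also have "\<dots> \<le> radius j" using ij by (intro radius_mono) simp
  also have "\<dots> < \<delta> (vs ! j)" using layers_nth(1) ij layers_arrangement(1) by simp
  finally show "X (vs ! j) < X (vs ! i)"
    using ij layers_arrangement(1) by (intro conn_weight_less layers_nth_less) auto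
qed

lemma sum_outside_le_tail_sum: "(\<Sum>v\<in>{..<n} - set vs. X v) \<le> tail_sum xs x"
proof -
  let ?tail = "\<lambda>v. X v * indicator {radius k<..} (\<delta> v)"
  have "(\<Sum>v\<in>{..<n} - set vs. X v) = (\<Sum>v\<in>{..<n} - set vs. ?tail v)"
    using layers_outside by (intro sum.cong) auto
  also have "\<dots> \<le> tail_sum xs x"
    unfolding tail_sum_def by (rule sum_mono2) (auto simp: conn_weight_nonneg)
  finally show ?thesis .
qed

lemma prob_nice_if_layered:
  assumes tail: "tail_sum xs x \<le> tail_bound * radius k powr (- real d / T)"
  shows "nice_const \<le> measure_pmf.prob (draw_seq X {..<n} k) {vs. nice_clause n X vs}"
  unfolding nice_const_def
proof (rule prob_nice_clause_ge[where vs = vs])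
  show "0 < X v" if "v < n" for v
    using rescaled_dist_pos[OF that] by (simp add: conn_weight_eq[OF that])
  show "vs \<in> arrangements k {..<n}"
    using layers by (simp add: layered_by_def)
  show "X v < X u" if "u \<in> set vs" "v < n" "v \<notin> set vs" for u v
    using layers_inside(2)[OF that(1)] layers_outside[OF that(2,3)] that layers_arrangement(2)
    by (intro conn_weight_less) auto
  show "(\<Sum>v\<in>{..<n} - set vs. X v) \<le> tail_bound * X u" if u: "u \<in> set vs" for u
  proof -
    have un: "u < n" using u layers_arrangement(2) by auto
    have "radius k powr (- real d / T) \<le> X u"
      unfolding conn_weight_eq[OF un] using layers_inside(2)[OF u] rescaled_dist_pos[OF un] T_pos
      by (intro powr_mono2') auto
    then have "tail_bound * radius k powr (- real d / T) \<le> tail_bound * X u"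
      using tail_bound_pos by simp
    then show ?thesis using sum_outside_le_tail_sum tail by linarith
  qed
qed (use tail_bound_pos sorted_wrt_conn_weight in simp_all)

end

lemma prob_nice_ge:
  assumes "\<And>v. v < n \<Longrightarrow> xs v \<in> unit_cube d" "promising xs x"
  shows "nice_const \<le> measure_pmf.prob
           (draw_seq (\<lambda>v. conn_weight T d p (w v) x (xs v)) {..<n} k)
           {vs. nice_clause n (\<lambda>v. conn_weight T d p (w v) x (xs v)) vs}"
  using assms prob_nice_if_layered by (auto simp: promising_def layered_def)

definition typical_variables :: "(nat \<Rightarrow> nat \<Rightarrow> real) set" where
  "typical_variables =
     {xs \<in> space (tuple_space d n). layer_const / 2 < layered_vol xs \<and> (\<forall>v<n. xs v \<in> unit_cube d)}"

definition num_promising :: "nat \<Rightarrow> (nat \<Rightarrow> nat \<Rightarrow> real) \<Rightarrow> (nat \<Rightarrow> nat \<Rightarrow> real) \<Rightarrow> nat" where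
  "num_promising m xs cs = card {c \<in> {..<m}. promising xs (cs c)}"

definition typical_positions :: "nat \<Rightarrow> ((nat \<Rightarrow> nat \<Rightarrow> real) \<times> (nat \<Rightarrow> nat \<Rightarrow> real)) set" where
  "typical_positions m = {z \<in> space (positions_space d n m).
     fst z \<in> typical_variables \<and> layer_const / 8 * real m \<le> real (num_promising m (fst z) (snd z))}"

lemma typical_variables_sets [measurable]: "typical_variables \<in> sets (tuple_space d n)"
proof -
  have [measurable]: "Measurable.pred (tuple_space d n) (\<lambda>xs. \<forall>v<n. xs v \<in> unit_cube d)"
    by (intro pred_intros_countable pred_intros_imp' pred_sets2[OF unit_cube_sets]
          tuple_component_measurable) auto
  show ?thesis unfolding typical_variables_def by measurable
qed

lemma num_promising_measurable [measurable]:
  "(\<lambda>z. num_promising m (fst z) (snd z))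
     \<in> measurable (tuple_space d n \<Otimes>\<^sub>M tuple_space d m) (count_space UNIV)"
  unfolding num_promising_def
proof (rule measurable_card)
  fix c
  show "{z \<in> space (tuple_space d n \<Otimes>\<^sub>M tuple_space d m). c \<in> {c \<in> {..<m}. promising (fst z) (snd z c)}}
      \<in> sets (tuple_space d n \<Otimes>\<^sub>M tuple_space d m)"
  proof (cases "c < m")
    case True
    then have [measurable]: "(\<lambda>z. snd z c) \<in> measurable (tuple_space d n \<Otimes>\<^sub>M tuple_space d m) (torus_space d)"
      by (rule tuple_component_measurable) simp
    show ?thesis using True by simp
  qed simp
qed

lemma typical_positions_sets: "typical_positions m \<in> sets (tuple_space d n \<Otimes>\<^sub>M tuple_space d m)"
  unfolding typical_positions_def positions_space_def by measurable

lemma prob_num_nice_ge_num_promising: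
  assumes cube: "\<And>v. v < n \<Longrightarrow> xs v \<in> unit_cube d"
  shows "1 - exp (- (nice_const\<^sup>2 / 2) * real (num_promising m xs cs))
           \<le> measure_pmf.prob (clause_draws T d p k w n m xs cs)
               {D. nice_const / 2 * real (num_promising m xs cs) \<le> real (num_nice T d p w n m xs cs D)}"
proof -
  let ?nice = "\<lambda>c. {vs. nice_clause n (\<lambda>v. conn_weight T d p (w v) (cs c) (xs v)) vs}"
  let ?draws = "clause_draws T d p k w n m xs cs"
  let ?G = "{c \<in> {..<m}. promising xs (cs c)}"
  have "1 - exp (- 2 * real (card ?G) * (nice_const / 2)\<^sup>2) \<le> measure_pmf.prob ?draws
      {D. real (card ?G) * (nice_const - nice_const / 2) \<le> real (card {c \<in> ?G. D c \<in> ?nice c})}"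
    unfolding clause_draws_def
    by (rule prob_Pi_pmf_card_ge) (use nice_const_pos cube in \<open>auto intro!: prob_nice_ge\<close>)
  also have "\<dots> \<le> measure_pmf.prob ?draws
      {D. nice_const / 2 * real (num_promising m xs cs) \<le> real (num_nice T d p w n m xs cs D)}"
  proof (intro measure_pmf.finite_measure_mono Collect_mono impI)
    fix D
    assume "real (card ?G) * (nice_const - nice_const / 2) \<le> real (card {c \<in> ?G. D c \<in> ?nice c})"
    also have "card {c \<in> ?G. D c \<in> ?nice c} \<le> num_nice T d p w n m xs cs D"
      unfolding num_nice_def by (intro card_mono) auto
    finally show "nice_const / 2 * real (num_promising m xs cs) \<le> real (num_nice T d p w n m xs cs D)"
      by (simp add: num_promising_def algebra_simps)
  qed simp
  finally show ?thesis
    by (simp add: num_promising_def power_divide mult_ac)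
qed

context
  fixes m :: nat and \<tau> :: real
  assumes \<tau>: "0 < \<tau>" "\<tau> \<le> real m" and \<tau>_w: "\<And>v. v < n \<Longrightarrow> \<tau> * w v \<le> real n"
begin

interpretation clauses: finite_product_prob_space "\<lambda>_. torus_space d" "{..<m}"
  by (rule finite_product_prob_space_torus)

interpretation positions: pair_prob_space "tuple_space d n" "tuple_space d m" ..

lemma exp_decay_le:
  assumes "decay_rate \<le> a" "\<tau> \<le> b"
  shows "exp (- a * b) \<le> exp (- decay_rate * \<tau>)"
proof -
  have "decay_rate * \<tau> \<le> a * b"
    using assms \<tau>(1) decay_rate_pos by (intro mult_mono) auto
  then show ?thesis by simp
qed

lemma prob_typical_variables_ge: "1 - exp (- decay_rate * \<tau>) \<le> variables.prob typical_variables"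
proof -
  have "1 - exp (- decay_rate * \<tau>) \<le> 1 - exp (- (layer_const\<^sup>2 * B / 2) * \<tau>)"
    using exp_decay_le[of "layer_const\<^sup>2 * B / 2" \<tau>] by (simp add: decay_rate_def)
  also have "\<dots> \<le> 1 - variables.prob {xs \<in> space (tuple_space d n). layered_vol xs \<le> layer_const / 2}"
    using prob_layered_vol_small_le[OF \<tau>(1) \<tau>_w] by simp
  also have "\<dots> = variables.prob {xs \<in> space (tuple_space d n). \<not> layered_vol xs \<le> layer_const / 2}"
    by (rule variables.prob_neg[symmetric]) measurable
  also have "\<dots> \<le> variables.prob typical_variables"
  proof (rule variables.finite_measure_mono_AE[OF _ typical_variables_sets])
    show "AE xs in tuple_space d n. xs \<in> {xs \<in> space (tuple_space d n). \<not> layered_vol xs \<le> layer_const / 2} \<longrightarrow>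
        xs \<in> typical_variables"
      using AE_tuple_unit_cube by eventually_elim (auto simp: typical_variables_def)
  qed
  finally show ?thesis .
qed

lemma prob_num_promising_ge:
  assumes xs: "xs \<in> typical_variables"
  shows "1 - exp (- decay_rate * \<tau>) \<le> measure (tuple_space d m)
           {cs \<in> space (tuple_space d m). layer_const / 8 * real m \<le> real (num_promising m xs cs)}"
proof -
  define S where "S = {x \<in> space (torus_space d). promising xs x}"
  have xs_space [measurable]: "xs \<in> space (tuple_space d n)"
    using xs by (simp add: typical_variables_def)
  have S_sets: "S \<in> torus.events" unfolding S_def by measurable
  have S_ge: "layer_const / 4 \<le> torus.prob S"
    unfolding S_def using xs by (intro prob_promising_ge xs_space) (auto simp: typical_variables_def)
  have num_eq: "card {c. c < m \<and> cs c \<in> S} = num_promising m xs cs"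
    if "cs \<in> space (tuple_space d m)" for cs
    unfolding num_promising_def S_def using that
    by (intro arg_cong[where f = card]) (auto simp: space_PiM PiE_iff)
  have "1 - exp (- decay_rate * \<tau>) \<le> 1 - exp (- (layer_const\<^sup>2 / 32) * real m)"
    using exp_decay_le[of "layer_const\<^sup>2 / 32" "real m"] \<tau>(2) by (simp add: decay_rate_def)
  also have "\<dots> = 1 - exp (- 2 * real (card {..<m}) * (layer_const / 8)\<^sup>2)"
    by (simp add: power_divide)
  also have "\<dots> \<le> clauses.prob {cs \<in> space (tuple_space d m).
      real (card {..<m}) * (layer_const / 4 - layer_const / 8) \<le> real (card {c \<in> {..<m}. cs c \<in> S})}"
    using layer_const_pos S_sets S_ge
    by (intro clauses.prob_card_components_ge) auto
  also have "\<dots> = clauses.prob {cs \<in> space (tuple_space d m).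
      layer_const / 8 * real m \<le> real (num_promising m xs cs)}"
    by (intro arg_cong[where f = clauses.prob] Collect_cong conj_cong refl) (simp add: num_eq mult.commute)
  finally show ?thesis .
qed

lemma emeasure_typical_positions_ge:
  "ennreal (1 - (exp (- decay_rate * \<tau>) + exp (- decay_rate * \<tau>)))
     \<le> emeasure (tuple_space d n \<Otimes>\<^sub>M tuple_space d m) (typical_positions m)"
proof -
  have slice: "ennreal (1 - exp (- decay_rate * \<tau>))
      \<le> emeasure (tuple_space d m) (Pair xs -` typical_positions m)"
    if xs: "xs \<in> typical_variables" for xs
  proof -
    have "xs \<in> space (tuple_space d n)"
      using xs by (simp add: typical_variables_def)
    then have "Pair xs -` typical_positions m
        = {cs \<in> space (tuple_space d m). layer_const / 8 * real m \<le> real (num_promising m xs cs)}"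
      using xs by (auto simp: typical_positions_def positions_space_def space_pair_measure)
    then show ?thesis
      using prob_num_promising_ge[OF xs] by (simp add: clauses.emeasure_eq_measure ennreal_leI)
  qed
  have "ennreal (1 - (exp (- decay_rate * \<tau>) + exp (- decay_rate * \<tau>)))
      \<le> (\<integral>\<^sup>+xs. emeasure (tuple_space d m) (Pair xs -` typical_positions m) \<partial>tuple_space d n)"
    using typical_variables_sets prob_typical_variables_ge slice
    by (rule variables.nn_integral_ge_if_prob_ge) auto
  also have "\<dots> = emeasure (tuple_space d n \<Otimes>\<^sub>M tuple_space d m) (typical_positions m)"
    by (rule clauses.emeasure_pair_measure_alt[symmetric, OF typical_positions_sets])
  finally show ?thesis .
qed

lemma prob_num_nice_given_positions_ge:
  assumes z: "(xs, cs) \<in> typical_positions m"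
  shows "1 - exp (- decay_rate * \<tau>) \<le> measure_pmf.prob (clause_draws T d p k w n m xs cs)
           {D. nice_density * real m \<le> real (num_nice T d p w n m xs cs D)}"
proof -
  let ?G = "real (num_promising m xs cs)"
  have cube: "xs v \<in> unit_cube d" if "v < n" for v
    using z that by (simp add: typical_positions_def typical_variables_def)
  have many: "layer_const / 8 * real m \<le> ?G"
    using z by (simp add: typical_positions_def)
  have "nice_const\<^sup>2 / 2 * (layer_const / 8 * real m) \<le> nice_const\<^sup>2 / 2 * ?G"
    using many by (rule mult_left_mono) simp
  then have "exp (- (nice_const\<^sup>2 / 2) * ?G) \<le> exp (- (layer_const * nice_const\<^sup>2 / 16) * real m)"
    by (simp add: mult_ac)
  also have "\<dots> \<le> exp (- decay_rate * \<tau>)"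
    using \<tau>(2) by (intro exp_decay_le) (simp_all add: decay_rate_def)
  finally have "1 - exp (- decay_rate * \<tau>) \<le> 1 - exp (- (nice_const\<^sup>2 / 2) * ?G)"
    by simp
  also have "\<dots> \<le> measure_pmf.prob (clause_draws T d p k w n m xs cs)
      {D. nice_const / 2 * ?G \<le> real (num_nice T d p w n m xs cs D)}"
    using cube by (rule prob_num_nice_ge_num_promising)
  also have "\<dots> \<le> measure_pmf.prob (clause_draws T d p k w n m xs cs)
      {D. nice_density * real m \<le> real (num_nice T d p w n m xs cs D)}"
  proof (rule measure_pmf.finite_measure_mono)
    have "nice_density * real m = nice_const / 2 * (layer_const / 8 * real m)"
      by (simp add: nice_density_def)
    also have "\<dots> \<le> nice_const / 2 * ?G"
      using many nice_const_pos by (intro mult_left_mono) auto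
    finally show "{D. nice_const / 2 * ?G \<le> real (num_nice T d p w n m xs cs D)}
        \<subseteq> {D. nice_density * real m \<le> real (num_nice T d p w n m xs cs D)}"
      by auto
  qed simp
  finally show ?thesis .
qed

theorem prob_num_nice_ge:
  "ennreal (1 - 3 * exp (- decay_rate * \<tau>))
     \<le> prob_num_nice T d p k w n m (\<lambda>N. nice_density * real m \<le> real N \<and> real N \<le> 1 * real m)"
proof -
  let ?E = "exp (- decay_rate * \<tau>)"
  let ?nice = "\<lambda>z. {D. nice_density * real m \<le> real (num_nice T d p w n m (fst z) (snd z) D) \<and>
    real (num_nice T d p w n m (fst z) (snd z) D) \<le> 1 * real m}"
  have "num_nice T d p w n m xs cs D \<le> m" for xs cs D
    unfolding num_nice_def by (rule order_trans[OF card_mono[of "{..<m}"]]) auto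
  then have "ennreal (1 - ?E) \<le> emeasure (clause_draws T d p k w n m (fst z) (snd z)) (?nice z)"
    if "z \<in> typical_positions m" for z
    using prob_num_nice_given_positions_ge[of "fst z" "snd z"] that
    by (simp add: measure_pmf.emeasure_eq_measure ennreal_leI)
  moreover have "1 - (?E + ?E) \<le> positions.prob (typical_positions m)"
    using emeasure_typical_positions_ge by (simp add: positions.emeasure_eq_measure ennreal_le_iff)
  ultimately have "ennreal (1 - ((?E + ?E) + ?E)) \<le>
      (\<integral>\<^sup>+z. emeasure (clause_draws T d p k w n m (fst z) (snd z)) (?nice z)
         \<partial>(tuple_space d n \<Otimes>\<^sub>M tuple_space d m))"
    by (intro positions.nn_integral_ge_if_prob_ge[OF typical_positions_sets]) auto
  then show ?thesis
    by (simp add: prob_num_nice_def positions_space_def)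
qed

end

end

section \<open>Asymptotics\<close>

lemma decay_scale_exists:
  fixes w :: "nat \<Rightarrow> nat \<Rightarrow> real" and m :: "nat \<Rightarrow> nat"
  assumes "\<epsilon> > 0" and m: "(\<lambda>n. real (m n)) \<in> \<Omega>(\<lambda>n. real n)"
    and w: "eventually (\<lambda>n. \<forall>v<n. w n v \<le> C * real n powr (1 - \<epsilon>)) at_top"
  obtains \<gamma> e :: real where "0 < \<gamma>" "0 < e"
    "eventually (\<lambda>n. \<gamma> * real n powr e \<le> real (m n) \<and> (\<forall>v<n. \<gamma> * real n powr e * w n v \<le> real n)) at_top"
proof -
  obtain a where a: "0 < a" "eventually (\<lambda>n. a * norm (real n) \<le> norm (real (m n))) at_top"
    using m by (rule landau_omega.bigE)
  define C' where "C' = max C 1"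
  define \<gamma> where "\<gamma> = min a (1 / C')"
  define e where "e = min 1 \<epsilon>"
  have C': "0 < C'" "C \<le> C'" by (auto simp: C'_def)
  have \<gamma>: "0 < \<gamma>" "\<gamma> \<le> a" "\<gamma> \<le> 1 / C'" using a(1) C' by (auto simp: \<gamma>_def)
  have "eventually (\<lambda>n. \<gamma> * real n powr e \<le> real (m n) \<and> (\<forall>v<n. \<gamma> * real n powr e * w n v \<le> real n)) at_top"
    using a(2) w eventually_gt_at_top[of 0]
  proof eventually_elim
    case (elim n)
    then have n: "1 \<le> real n" by simp
    have "real n powr e \<le> real n powr 1" using n by (intro powr_mono) (auto simp: e_def)
    then have "\<gamma> * real n powr e \<le> a * real n" using \<gamma> n by (intro mult_mono) auto
    moreover have "\<gamma> * real n powr e * w n v \<le> real n" if v: "v < n" for v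
    proof -
      have "w n v \<le> C * real n powr (1 - \<epsilon>)" using elim(2) v by blast
      also have "\<dots> \<le> C' * real n powr (1 - \<epsilon>)" using C' by (intro mult_right_mono) auto
      finally have "\<gamma> * real n powr e * w n v \<le> \<gamma> * real n powr e * (C' * real n powr (1 - \<epsilon>))"
        using \<gamma>(1) by (intro mult_left_mono) auto
      also have "\<dots> \<le> 1 / C' * real n powr \<epsilon> * (C' * real n powr (1 - \<epsilon>))"
        using \<gamma> C' n by (intro mult_mono powr_mono) (auto simp: e_def)
      also have "\<dots> = real n powr (\<epsilon> + (1 - \<epsilon>))" using C' by (simp only: powr_add) simp
      also have "\<dots> = real n" using n by simp
      finally show ?thesis .
    qed
    ultimately show ?case using elim(1) by simp
  qed
  then show thesis using \<gamma>(1) \<open>\<epsilon> > 0\<close> by (intro that[of \<gamma> e]) (auto simp: e_def)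
qed

theorem mainTheorem11:
  fixes d k :: nat and p :: enat and T \<epsilon> :: real
    and w :: "nat \<Rightarrow> nat \<Rightarrow> real"  \<comment> \<open>w n v: weight of variable v in the instance with n variables\<close>
    and m :: "nat \<Rightarrow> nat"           \<comment> \<open>m n: number of clauses\<close>
  assumes d_pos: "d \<ge> 1"
    and p_pos: "p \<ge> 1"
    and T: "0 < T" "T < 1"
    and eps: "\<epsilon> > 0"
    and w_ge1: "\<And>n v. v < n \<Longrightarrow> w n v \<ge> 1"
    and w_min: "\<And>n. n \<ge> 1 \<Longrightarrow> (\<exists>v<n. w n v = 1)"
    and m_lin: "(\<lambda>n. real (m n)) \<in> \<Theta>(\<lambda>n. real n)"
    and W_lin: "(\<lambda>n. \<Sum>v<n. w n v) \<in> O(\<lambda>n. real n)"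
    and w_max: "\<exists>C. eventually (\<lambda>n. \<forall>v<n. w n v \<le> C * real n powr (1 - \<epsilon>)) at_top"
  shows "\<exists>c1 c2 C. c1 > 0 \<and> c2 > 0 \<and>
           eventually (\<lambda>n. prob_num_nice T d p k (w n) n (m n)
                (\<lambda>N. c1 * real (m n) \<le> real N \<and> real N \<le> c2 * real (m n))
              \<ge> ennreal (1 - C / real n)) at_top"
proof -
  obtain B where B: "B > 0" "eventually (\<lambda>n. norm (\<Sum>v<n. w n v) \<le> B * norm (real n)) at_top"
    using W_lin by (rule landau_o.bigE)
  obtain \<gamma> e where "0 < \<gamma>" "0 < e" and scale: "eventually (\<lambda>n. \<gamma> * real n powr e \<le> real (m n) \<and>
      (\<forall>v<n. \<gamma> * real n powr e * w n v \<le> real n)) at_top"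
    using w_max decay_scale_exists[OF eps bigthetaD2[OF m_lin]] by blast
  interpret geometric_model d k p T B
    by unfold_locales (use d_pos p_pos T B(1) in auto)
  have decay: "eventually (\<lambda>n. 1 - 3 / real n \<le> 1 - 3 * exp (- decay_rate * (\<gamma> * real n powr e))) at_top"
    using decay_rate_pos \<open>0 < \<gamma>\<close> \<open>0 < e\<close> by real_asymp
  have "eventually (\<lambda>n. ennreal (1 - 3 / real n) \<le> prob_num_nice T d p k (w n) n (m n)
      (\<lambda>N. nice_density * real (m n) \<le> real N \<and> real N \<le> 1 * real (m n))) at_top"
    using B(2) scale decay eventually_ge_at_top[of "2 * k"] eventually_gt_at_top[of 0]
  proof eventually_elim
    case (elim n)
    interpret geometric_instance d k p T B n "w n"
      by unfold_locales (use elim w_ge1 in auto)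
    have "ennreal (1 - 3 * exp (- decay_rate * (\<gamma> * real n powr e))) \<le> prob_num_nice T d p k (w n) n (m n)
        (\<lambda>N. nice_density * real (m n) \<le> real N \<and> real N \<le> 1 * real (m n))"
      using elim \<open>0 < \<gamma>\<close> by (intro prob_num_nice_ge) auto
    then show ?case using ennreal_leI[OF elim(3)] by (rule order_trans[rotated])
  qed
  then show ?thesis using nice_density_pos zero_less_one by blast
qed

end
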